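(* Assume the convex setting described in the context, and suppose that for each $\xi\in\Xi$, \[\operatorname{dom}f_\xi=\{x:c_k(x)\le\ell_k(\xi),\ k\in[m]\},\] where each $c_k:\mathbb{R}^n\to\mathbb{R}$ is convex and each $\ell_k$ is a real random variable on $\Xi$. Let $J=\{k\in[m]:\exists x\in\mathcal X^*,\ c_k(x)=(\ell_k)_0\}$. Suppose there is $\kappa:\Xi\to\mathbb{R}_+$ with $\mathbb{E}[\kappa(\xi)]=L$ such that $f_\xi$ is $\kappa(\xi)$-Lipschitz on $\operatorname{dom}f_\xi$ for every $\xi\in\Xi$, and that on every compact $X\subset\operatorname{dom}F$: (C1) for every $x\in X$, $\mathbb{E}[e^{t(f_\xi(x)-F(x))}]$ is finite for $t$ in a neighborhood of $0$; (C3) $\mathbb{E}[e^{t\kappa(\xi)}]$ is finite for $t$ in a neighborhood of $0$. Then there exist $\bar\alpha>0$ and positive constants $C,\beta$ (independent of $N$) such that for every $N\ge|J|$ and every $\alpha\in[0,\bar\alpha)$, \[\mathbb{P}^N\{d(x^*(\xi^{[N]}))<1-\alpha\}\le Ce^{-N\beta}+\sum_{k=0}^{|J|-1}\binom{N}{k}\alpha^k(1-\alpha)^{N-k}.\]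
   Context: Setting: $\mathcal{X}\subseteq\mathbb{R}^n$ is a nonempty closed convex set; $\xi$ is a random vector with support $\Xi$ and distribution $\mathbb P$; for each $\xi\in\Xi$, $f_\xi:\mathbb{R}^n\to\mathbb{R}\cup\{+\infty\}$ is convex; $F(x)=\mathbb{E}[f_\xi(x)]$, with $F>-\infty$ and $F(x)<+\infty$ for some $x\in\mathcal X$; $\operatorname{dom}F=\{x:F(x)<+\infty\}$; the optimal set $\mathcal X^*$ of $\inf_{x\in\mathcal X}F(x)$ is nonempty and compact. For $\beta\in[0,1)$, $(\ell_k)_\beta=\inf\{t\in\mathbb{R}:\mathbb P\{\ell_k\le t\}>\beta\}$; in particular $(\ell_k)_0$ is the essential infimum of $\ell_k$. $\xi^{[N]}$ is an i.i.d. sample of size $N$ with product measure $\mathbb P^N$, $\hat F_N(x)=\frac1N\sum_{i=1}^Nf_{\xi^i}(x)$, and $x^*(\xi^{[N]})$ is an optimal solution of $\inf_{x\in\mathcal X}\hat F_N(x)$ assigned to each sample. Degree of feasibility: $d(x^*(\xi^{[N]}))=\mathbb{P}\{\xi\in\Xi:f_\xi(x^*(\xi^{[N]}))<+\infty\}$. $[m]=\{1,\dots,m\}$. *)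

theory Defs
  imports "HOL-Probability.Probability"
begin

text \<open>Convexity of an extended-real-valued function (values in the reals or plus infinity).\<close>
definition convex_ext :: "('a::real_vector \<Rightarrow> ereal) \<Rightarrow> bool" where
  "convex_ext g \<longleftrightarrow> (\<forall>x y t. 0 \<le> t \<and> t \<le> 1 \<longrightarrow>
      g ((1 - t) *\<^sub>R x + t *\<^sub>R y) \<le> ereal (1 - t) * g x + ereal t * g y)"

definition expect_ext :: "'b measure \<Rightarrow> ('b \<Rightarrow> ereal) \<Rightarrow> ereal" where
  "expect_ext M g =
     (if (\<integral>\<^sup>+ \<xi>. e2ennreal (- g \<xi>) \<partial>M) = \<infinity> then -\<infinity>
      else enn2ereal (\<integral>\<^sup>+ \<xi>. e2ennreal (g \<xi>) \<partial>M) - enn2ereal (\<integral>\<^sup>+ \<xi>. e2ennreal (- g \<xi>) \<partial>M))"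

definition Fobj :: "'b measure \<Rightarrow> ('b \<Rightarrow> 'a \<Rightarrow> ereal) \<Rightarrow> 'a \<Rightarrow> ereal" where
  "Fobj M f x = expect_ext M (\<lambda>\<xi>. f \<xi> x)"

definition opt_set :: "'b measure \<Rightarrow> ('b \<Rightarrow> 'a \<Rightarrow> ereal) \<Rightarrow> 'a set \<Rightarrow> 'a set" where
  "opt_set M f X = {x \<in> X. Fobj M f x = (INF y\<in>X. Fobj M f y)}"

text \<open>Level-beta quantile: inf { t | P(g \<le> t) > beta } (as an extended real);
  for beta = 0 this is the essential infimum.\<close>
definition quantile_lvl :: "'b measure \<Rightarrow> ('b \<Rightarrow> real) \<Rightarrow> real \<Rightarrow> ereal" where
  "quantile_lvl M g \<beta> = Inf (ereal ` {t. measure M {\<xi> \<in> space M. g \<xi> \<le> t} > \<beta>})"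

definition outer_prob :: "'b measure \<Rightarrow> 'b set \<Rightarrow> real" where
  "outer_prob M A = Inf {measure M B | B. B \<in> sets M \<and> A \<subseteq> B}"

definition saa :: "('b \<Rightarrow> 'a \<Rightarrow> ereal) \<Rightarrow> nat \<Rightarrow> (nat \<Rightarrow> 'b) \<Rightarrow> 'a \<Rightarrow> ereal" where
  "saa f N \<omega> x = ereal (1 / real N) * (\<Sum>i<N. f (\<omega> i) x)"

definition feas_degree :: "'b measure \<Rightarrow> ('b \<Rightarrow> 'a \<Rightarrow> ereal) \<Rightarrow> 'a \<Rightarrow> real" where
  "feas_degree M f x = measure M {\<xi> \<in> space M. f \<xi> x < \<infinity>}"

end

theory Submission
  imports Defs
begin

text \<open>
  With exponentially high probability the sample solution lies so close to the compact optimal set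
  that the constraints outside \<open>J\<close>, which are strict there, hold almost surely: on the sphere of
  radius \<open>\<epsilon>\<close> around the optimal set the objective has a positive gap, and by convexity it suffices to
  control the sample averages at finitely many points of this sphere, at one optimal point, and of
  the Lipschitz modulus, which is done by Chernoff bounds. A solution feasible for all samples then
  violates a fresh constraint only if \<open>ell k\<close> falls below its sample minimum for some \<open>k\<close> in \<open>J\<close>. The
  probability of this is handled by a distribution-free tolerance bound, proved by
  removing the sample point that minimises one of the \<open>ell k\<close> and inducting on the size of \<open>J\<close>.
\<close>

section \<open>The tolerance bound for sample minima\<close>

text \<open>What survives there is that each sampled function is Lipschitz on its own domain, which
  carries estimates from points in the domain of \<open>F\<close> to nearby sample-feasible points.
  The tolerance event mentions only the fresh point and the sample, never the solution. It therefore
  serves every selection of minimisers, measurable or not: the bad set only has to be covered by one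
  exponentially small event and one tolerance event. A union bound over \<open>J\<close> would have
  to share \<alpha> among the constraints and would lose the binomial form. The binomial sum is the
  probability that fewer than \<open>card J\<close> of \<open>N\<close> uniform points fall below
  \<alpha>; the induction follows its recursion obtained by conditioning on the smallest point.
  Since failures outside \<open>J\<close> are charged to the exponential term whatever \<alpha> is,
  every \<alpha> below 1 is admissible.\<close>

text \<open>The probability integral transform, for a finite measure of arbitrary mass. The two
  sides are compared by their distribution functions: at a level \<open>s\<close> inside the range,
  the sublevel set of \<open>cdf M\<close> is a closed left ray, and continuity makes the mass of
  that ray exactly \<open>s\<close>.\<close>

lemma (in finite_borel_measure) distr_cdf_uniform:
  assumes cont: "\<And>x. isCont (cdf M) x"
  shows "distr M borel (cdf M) = density lborel (indicator {0..measure M (space M)})"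
proof -
  define a where "a = measure M (space M)"
  have a0: "0 \<le> a" by (simp add: a_def)
  have contU: "continuous_on UNIV (cdf M)"
    using cont by (simp add: continuous_on_eq_continuous_at)
  have meas: "cdf M \<in> borel_measurable M"
    using borel_measurable_continuous_onI[OF contU] M_is_borel by (simp cong: measurable_cong_sets)
  let ?D = "distr M borel (cdf M)" and ?U = "density lborel (indicator {0..a} :: real \<Rightarrow> ennreal)"
  have D: "finite_borel_measure ?D"
    using finite_measure_distr[OF meas] 
    by (simp add: finite_borel_measure_def finite_borel_measure_axioms_def)
  have emU: "emeasure ?U S = emeasure lborel ({0..a} \<inter> S)" if "S \<in> sets borel" for S
    using that by (subst emeasure_density) (auto simp: nn_integral_indicator[symmetric] 
        intro!: nn_integral_cong split: split_indicator simp del: nn_integral_indicator)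
  have U: "finite_borel_measure ?U"
    using a0 by (auto simp: finite_borel_measure_def finite_borel_measure_axioms_def emU intro!: finite_measureI)
  have "cdf ?D s = cdf ?U s" for s
  proof -
    have l: "cdf ?D s = measure M {x. cdf M x \<le> s}"
      using meas by (simp add: cdf_def measure_distr borel_UNIV vimage_def)
    have r: "cdf ?U s = (if s < 0 then 0 else min s a)"
    proof -
      have "{0..a} \<inter> {..s} = {0..min s a}" by auto
      then show ?thesis using a0 by (auto simp: cdf_def measure_def emU)
    qed
    consider "s < 0" | "0 \<le> s" "s < a" | "a \<le> s" by linarith
    then show ?thesis
    proof cases
      case 1
      then have "{x. cdf M x \<le> s} = {}" using cdf_nonneg by (auto simp: not_le intro: less_le_trans)
      then show ?thesis using l r 1 by simp
    next
      case 3
      then have "{x. cdf M x \<le> s} = UNIV" using cdf_bounded by (auto simp: a_def intro: order_trans)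
      then show ?thesis using l r 3 a0 by (simp add: a_def borel_UNIV)
    next
      case 2
      define S where "S = {x. cdf M x \<le> s}"
      have "\<forall>\<^sub>F x in at_top. s < cdf M x"
        using order_tendstoD(1)[OF cdf_lim_at_top] 2 by (simp add: a_def)
      then obtain B where B: "\<And>x. x \<ge> B \<Longrightarrow> s < cdf M x" by (auto simp: eventually_at_top_linorder)
      have bdd: "bdd_above S"
        proof (rule bdd_aboveI)
        show "x \<le> B" if "x \<in> S" for x
          using B[of x] that by (cases "B \<le> x") (auto simp: S_def)
      qed
      show ?thesis
      proof (cases "S = {}")
        case True
        \<comment> \<open>As \<open>cdf M\<close> tends to 0 at minus infinity, its sublevel set can
          be empty only at level 0, where both sides vanish.\<close>
        have "s = 0"
        proof (rule ccontr)
          assume "s \<noteq> 0"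
          then have "\<forall>\<^sub>F x in at_bot. cdf M x < s"
            using order_tendstoD(2)[OF cdf_lim_at_bot] 2 by simp
          then obtain x where "cdf M x < s" by (auto simp: eventually_at_bot_linorder)
          then have "x \<in> S" by (simp add: S_def)
          then show False using True by simp
        qed
        then show ?thesis using l r True 2 by (simp add: S_def)
      next
        case False
        have "closed S" unfolding S_def by (intro closed_Collect_le contU continuous_on_const)
        then have t: "Sup S \<in> S" by (rule closed_contains_Sup[OF False bdd])
        have S: "S = {..Sup S}"
        proof
          show "S \<subseteq> {..Sup S}" using bdd by (auto intro: cSup_upper)
          show "{..Sup S} \<subseteq> S"
            using t cdf_nondecreasing unfolding S_def by (auto intro: order_trans)
        qed
        \<comment> \<open>By continuity, a value below \<open>s\<close> at the supremum would
          persist slightly to its right, inside \<open>S\<close>.\<close>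
        have "cdf M (Sup S) = s"
        proof (rule ccontr)
          assume "cdf M (Sup S) \<noteq> s"
          then have "cdf M (Sup S) < s" using t by (simp add: S_def)
          then have "\<forall>\<^sub>F x in at (Sup S). cdf M x < s"
            using cont[of "Sup S"] by (intro order_tendstoD(2)) (auto simp: isCont_def)
          then have "\<forall>\<^sub>F x in at_right (Sup S). cdf M x < s"
            by (simp add: eventually_at_split)
          then obtain b where "b > Sup S" "\<forall>y>Sup S. y < b \<longrightarrow> cdf M y < s"
            by (auto simp: eventually_at_right_field)
          moreover obtain x where "Sup S < x" "x < b" using dense[OF \<open>b > Sup S\<close>] by auto
          ultimately have "x > Sup S" "cdf M x < s" by auto
          then have "x \<in> S" by (simp add: S_def)
          then show False using \<open>x > Sup S\<close> bdd by (meson cSup_upper leD)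
        qed
        then have "measure M S = s" using S by (simp add: cdf_def)
        then show ?thesis using l r 2 by (simp add: S_def)
      qed
    qed
  qed
  then have "cdf ?D = cdf ?U" by auto
  then show ?thesis using cdf_unique'[OF D U] by (simp add: a_def)
qed

text \<open>The mass in \<open>A\<close> below level \<open>g \<xi>\<close> is the distribution
  function of \<open>g\<close> under \<open>M\<close> restricted to \<open>A\<close>, evaluated at
  \<open>g \<xi>\<close>. Without atoms, strict and weak inequality give the same mass and this
  function is continuous, so the transform above applies.\<close>

lemma nn_integral_rank:
  fixes g :: "'b \<Rightarrow> real"
  assumes "prob_space M" and [measurable]: "g \<in> borel_measurable M" "A \<in> sets M" "h \<in> borel_measurable borel"
    and atomless: "\<And>y. measure M {\<xi> \<in> space M. g \<xi> = y} = 0"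
  shows "(\<integral>\<^sup>+\<xi>. h (measure M {\<eta> \<in> A. g \<eta> < g \<xi>}) * indicator A \<xi> \<partial>M)
       = (\<integral>\<^sup>+s. h s * indicator {0..measure M A} s \<partial>lborel)"
proof -
  interpret prob_space M by fact
  have AM: "A \<subseteq> space M" by (simp add: sets.sets_into_space)
  define D where "D = density M (indicator A)"
  define \<nu> where "\<nu> = distr D borel g"
  have emD: "emeasure D S = emeasure M (A \<inter> S)" if "S \<in> sets M" for S
    using that unfolding D_def by (subst emeasure_density) (auto simp: nn_integral_indicator[symmetric] 
        intro!: nn_integral_cong split: split_indicator simp del: nn_integral_indicator)
  have gD[measurable]: "g \<in> borel_measurable D" by (simp add: D_def)
  have "finite_measure D"
    using emD[of "space M"] by (intro finite_measureI) (simp add: D_def)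
  then interpret \<nu>: finite_borel_measure \<nu>
    by (simp add: \<nu>_def finite_borel_measure_def finite_borel_measure_axioms_def finite_measure.finite_measure_distr)
  have m\<nu>: "measure \<nu> S = measure M {\<eta> \<in> A. g \<eta> \<in> S}" if [measurable]: "S \<in> sets borel" for S
  proof -
    have "measure \<nu> S = measure D {\<eta> \<in> space M. g \<eta> \<in> S}"
      unfolding \<nu>_def by (subst measure_distr) (auto simp: D_def vimage_def Int_def intro!: arg_cong[where f="measure _"])
    also have "\<dots> = measure M (A \<inter> {\<eta> \<in> space M. g \<eta> \<in> S})"
      by (simp add: measure_def emD)
    also have "A \<inter> {\<eta> \<in> space M. g \<eta> \<in> S} = {\<eta> \<in> A. g \<eta> \<in> S}" using AM by auto
    finally show ?thesis .
  qed
  have zero: "measure M {\<eta> \<in> A. g \<eta> = y} = 0" for y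
  proof -
    have "measure M {\<eta> \<in> A. g \<eta> = y} \<le> measure M {\<eta> \<in> space M. g \<eta> = y}"
      using AM by (intro finite_measure_mono) auto
    then show ?thesis using atomless[of y] by (simp add: measure_le_0_iff)
  qed
  have cont: "isCont (cdf \<nu>) x" for x
    using zero[of x] by (simp add: \<nu>.isCont_cdf m\<nu>)
  have cdf: "cdf \<nu> y = measure M {\<eta> \<in> A. g \<eta> < y}" for y
  proof -
    have 1: "{\<eta> \<in> A. g \<eta> \<in> {..y}} = {\<eta> \<in> A. g \<eta> < y} \<union> {\<eta> \<in> A. g \<eta> = y}" by auto
    have m: "{\<eta> \<in> A. g \<eta> < y} \<in> sets M" "{\<eta> \<in> A. g \<eta> = y} \<in> sets M" by measurable
    have 2: "measure \<nu> {..y} = measure M {\<eta> \<in> A. g \<eta> \<in> {..y}}" by (rule m\<nu>) simp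
    show ?thesis
      unfolding cdf_def2 2 1 by (subst finite_measure_Union[OF m]) (auto simp: zero)
  qed
  have "continuous_on UNIV (cdf \<nu>)" using cont by (simp add: continuous_on_eq_continuous_at)
  then have cdfm[measurable]: "cdf \<nu> \<in> borel_measurable borel" by (rule borel_measurable_continuous_onI)
  have cdfm': "cdf \<nu> \<in> borel_measurable \<nu>" using cdfm by (simp add: \<nu>_def)
  have sp: "measure \<nu> (space \<nu>) = measure M A" using m\<nu>[of UNIV] by (simp add: \<nu>.borel_UNIV)
  have "(\<integral>\<^sup>+\<xi>. h (measure M {\<eta> \<in> A. g \<eta> < g \<xi>}) * indicator A \<xi> \<partial>M) = (\<integral>\<^sup>+\<xi>. h (cdf \<nu> (g \<xi>)) \<partial>D)"
    unfolding cdf D_def[symmetric]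
    unfolding D_def by (subst nn_integral_density) (auto simp: cdf[symmetric] mult.commute)
  also have "\<dots> = (\<integral>\<^sup>+x. h (cdf \<nu> x) \<partial>distr D borel g)"
    by (rule nn_integral_distr[symmetric]) auto
  also have "\<dots> = (\<integral>\<^sup>+x. h (cdf \<nu> x) \<partial>\<nu>)"
    by (simp only: \<nu>_def)
  also have "\<dots> = (\<integral>\<^sup>+s. h s \<partial>distr \<nu> borel (cdf \<nu>))"
    by (subst nn_integral_distr) (auto intro: cdfm')
  also have "\<dots> = (\<integral>\<^sup>+s. h s \<partial>density lborel (indicator {0..measure M A}))"
    by (simp add: \<nu>.distr_cdf_uniform[OF cont] sp)
  also have "\<dots> = (\<integral>\<^sup>+s. h s * indicator {0..measure M A} s \<partial>lborel)"
    by (subst nn_integral_density) (auto simp: mult.commute)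
  finally show ?thesis .
qed

text \<open>The total probability formula behind the induction. Take \<open>Suc n\<close> points in
  \<open>[0, a]\<close> and condition on the smallest, \<open>s\<close>; the factor
  \<open>Suc n\<close> counts which one it is. Fewer than \<open>Suc r\<close> points lie below
  \<alpha> if either \<open>s\<close> exceeds \<alpha>, or fewer than \<open>r\<close> of the other
  \<open>n\<close> points lie between \<open>s\<close> and \<alpha>.\<close>

lemma nn_integral_binomial_split:
  fixes a \<alpha> :: real and n r :: nat
  assumes "0 \<le> \<alpha>" "\<alpha> \<le> a"
  shows "ennreal (real (Suc n)) * (\<integral>\<^sup>+s. (if s \<le> \<alpha> then ennreal (\<Sum>j<r. real (n choose j) * (\<alpha> - s) ^ j * (a - \<alpha>) ^ (n - j))
            else ennreal ((a - s) ^ n)) * indicator {0..a} s \<partial>lborel)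
       \<le> ennreal (\<Sum>j<Suc r. real (Suc n choose j) * \<alpha> ^ j * (a - \<alpha>) ^ (Suc n - j))"
    (is "_ * ?I \<le> ennreal ?R")
proof -
  define b where "b = a - \<alpha>"
  have b: "0 \<le> b" using assms by (simp add: b_def)
  define f1 where "f1 s = (\<Sum>j<r. real (n choose j) * (\<alpha> - s) ^ j * b ^ (n - j))" for s :: real
  define F1 where "F1 s = (\<Sum>j<r. - (real (n choose j) * ((\<alpha> - s) ^ Suc j / real (Suc j)) * b ^ (n - j)))" for s :: real
  define F2 where "F2 s = - ((a - s) ^ Suc n / real (Suc n))" for s :: real
  have [measurable]: "f1 \<in> borel_measurable borel" unfolding f1_def by measurable
  have pw: "((\<lambda>s. (u - s) ^ Suc j / real (Suc j)) has_real_derivative - ((u - x) ^ j)) (at x within S)"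
    for u x :: real and j S
    by (rule derivative_eq_intros refl | simp)+ 
  have 1: "(\<integral>\<^sup>+s. ennreal (f1 s) * indicator {0..\<alpha>} s \<partial>lborel) = ennreal (F1 \<alpha> - F1 0)"
  proof (rule nn_integral_FTC_Icc)
    fix x assume "x \<in> {0..\<alpha>}"
    then have x: "0 \<le> x" "x \<le> \<alpha>" by auto
    show "0 \<le> f1 x" unfolding f1_def using x b by (intro sum_nonneg mult_nonneg_nonneg) auto
    have "(F1 has_real_derivative (\<Sum>j<r. - (real (n choose j) * (- ((\<alpha> - x) ^ j)) * b ^ (n - j)))) (at x)"
      unfolding F1_def by (intro derivative_intros DERIV_sum DERIV_minus DERIV_cmult_right DERIV_cmult pw)
    then show "(F1 has_real_derivative f1 x) (at x)"
      by (simp add: f1_def)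
  qed (use assms in auto)
  have 2: "(\<integral>\<^sup>+s. ennreal ((a - s) ^ n) * indicator {\<alpha>..a} s \<partial>lborel) = ennreal (F2 a - F2 \<alpha>)"
  proof (rule nn_integral_FTC_Icc)
    fix x assume "x \<in> {\<alpha>..a}"
    then show "0 \<le> (a - x) ^ n" by simp
    show "(F2 has_real_derivative (a - x) ^ n) (at x)"
      unfolding F2_def using DERIV_minus[OF pw[of a n x]] by simp
  qed (use assms in auto)
  \<comment> \<open>The two pieces overlap at the single point \<alpha>, which is why the pointwise
    comparison is an inequality.\<close>
  have "?I \<le> (\<integral>\<^sup>+s. ennreal (f1 s) * indicator {0..\<alpha>} s + ennreal ((a - s) ^ n) * indicator {\<alpha>..a} s \<partial>lborel)"
    by (intro nn_integral_mono) (auto simp: f1_def b_def split: split_indicator)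
  also have "\<dots> = ennreal (F1 \<alpha> - F1 0) + ennreal (F2 a - F2 \<alpha>)"
    by (subst nn_integral_add) (auto simp: 1 2)
  finally have I: "?I \<le> ennreal (F1 \<alpha> - F1 0) + ennreal (F2 a - F2 \<alpha>)" .
  have F1: "F1 \<alpha> - F1 0 = (\<Sum>j<r. real (n choose j) * (\<alpha> ^ Suc j / real (Suc j)) * b ^ (n - j))"
    by (simp add: F1_def sum_negf)
  have F2: "F2 a - F2 \<alpha> = b ^ Suc n / real (Suc n)"
    by (simp add: F2_def b_def)
  have nn: "0 \<le> F1 \<alpha> - F1 0" "0 \<le> F2 a - F2 \<alpha>"
    unfolding F1 F2 using b assms by (auto intro!: sum_nonneg mult_nonneg_nonneg divide_nonneg_nonneg)
  \<comment> \<open>Integration raises the power of \<alpha> by one, and the absorption identity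
    turns term \<open>j\<close> for \<open>n\<close> into term \<open>Suc j\<close> for
    \<open>Suc n\<close>. The missing term 0 comes from the integral over
    \<open>{\<alpha>..a}\<close>.\<close>
  have bin: "real (Suc n) * (real (n choose j) * (\<alpha> ^ Suc j / real (Suc j)) * b ^ (n - j)) 
      = real (Suc n choose Suc j) * \<alpha> ^ Suc j * b ^ (n - j)" for j
  proof -
    have "real (Suc n) * real (n choose j) = real (Suc n choose Suc j) * real (Suc j)"
      using Suc_times_binomial_eq[of n j] by (metis of_nat_mult)
    then show ?thesis by (simp add: field_simps del: binomial_Suc_Suc of_nat_Suc)
  qed
  have "ennreal (real (Suc n)) * ?I \<le> ennreal (real (Suc n)) * (ennreal (F1 \<alpha> - F1 0) + ennreal (F2 a - F2 \<alpha>))"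
    using I by (intro mult_left_mono) auto
  also have "\<dots> = ennreal (real (Suc n) * (F1 \<alpha> - F1 0 + (F2 a - F2 \<alpha>)))"
    using nn by (simp add: ennreal_mult ennreal_plus del: of_nat_Suc)
  also have "real (Suc n) * (F1 \<alpha> - F1 0 + (F2 a - F2 \<alpha>)) = ?R"
    unfolding sum.lessThan_Suc_shift distrib_left F1 F2 sum_distrib_left bin
    by (simp add: b_def del: of_nat_Suc binomial_Suc_Suc)
  finally show ?thesis .
qed

section \<open>Undercutting the sample minima\<close>

text \<open>Quantifying over \<open>I\<close> instead of taking a minimum also covers an empty
  sample, for which the set is \<open>A\<close> unless \<open>K\<close> is empty. Both
  \<open>I\<close> and \<open>A\<close> are parameters because the induction deletes a sample index
  and shrinks \<open>A\<close> to an upper level set.\<close>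

definition undercut :: "('k \<Rightarrow> 'b \<Rightarrow> real) \<Rightarrow> 'k set \<Rightarrow> 'i set \<Rightarrow> 'b set \<Rightarrow> ('i \<Rightarrow> 'b) \<Rightarrow> 'b set" where
  "undercut g K I A \<omega> = {\<eta> \<in> A. \<exists>k\<in>K. \<forall>i\<in>I. g k \<eta> < g k (\<omega> i)}"

lemma undercut_sets:
  assumes "finite K" "finite I" "\<And>k. k \<in> K \<Longrightarrow> g k \<in> borel_measurable M" and [measurable]: "A \<in> sets M"
  shows "undercut g K I A \<omega> \<in> sets M"
proof -
  have [measurable]: "(\<lambda>x. g k x) \<in> borel_measurable M" if "k \<in> K" for k using assms(3)[OF that] .
  show ?thesis
    using assms(1,2) unfolding undercut_def by measurable
qed

text \<open>Two families are allowed because breaking ties later compares \<open>g k\<close> shifted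
  by a margin with the unshifted \<open>g k\<close>. The function is the measure of the sections of
  a jointly measurable set.\<close>

lemma measurable_exceedance:
  assumes M: "prob_space M" and K: "finite K" "\<And>k. k \<in> K \<Longrightarrow> g k \<in> borel_measurable M"
      "\<And>k. k \<in> K \<Longrightarrow> (h k :: 'b \<Rightarrow> real) \<in> borel_measurable M"
    and I: "finite I" and [measurable]: "A \<in> sets M"
  shows "(\<lambda>\<omega>. measure M {\<eta> \<in> A. \<exists>k\<in>K. \<forall>i\<in>I. g k \<eta> < h k (\<omega> i)}) \<in> borel_measurable (PiM I (\<lambda>_. M))"
proof -
  interpret prob_space M by fact
  have AM: "A \<subseteq> space M" by (simp add: sets.sets_into_space)
  have [measurable]: "g k \<in> borel_measurable M" "h k \<in> borel_measurable M" if "k \<in> K" for k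
    using K(2,3)[OF that] .
  have [measurable]: "(\<lambda>\<omega>. \<omega> i) \<in> measurable (PiM I (\<lambda>_. M)) M" if "i \<in> I" for i
    using that I by (intro measurable_component_singleton) auto
  have *: "{x \<in> space (PiM I (\<lambda>_. M) \<Otimes>\<^sub>M M). snd x \<in> A \<and> (\<exists>k\<in>K. \<forall>i\<in>I. g k (snd x) < h k (fst x i))}
     \<in> sets (PiM I (\<lambda>_. M) \<Otimes>\<^sub>M M)"
    using I K(1) by measurable
  show ?thesis unfolding measure_def
    by (intro borel_measurable_enn2real measurable_emeasure) (use * AM in auto)
qed

lemma measurable_undercut:
  assumes "prob_space M" "finite K" "\<And>k. k \<in> K \<Longrightarrow> g k \<in> borel_measurable M" "finite I" "A \<in> sets M"
  shows "(\<lambda>\<omega>. measure M (undercut g K I A \<omega>)) \<in> borel_measurable (PiM I (\<lambda>_. M))"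
  unfolding undercut_def by (intro measurable_exceedance assms)

text \<open>
  Split according to the index \<open>i\<close> minimising \<open>g k0\<close>. Given \<open>\<omega> i = \<xi>\<close>, the other sample points lie in
  the upper level set of \<open>g k0\<close> at \<open>\<xi>\<close>, whose complement in \<open>A\<close> has a mass \<open>p \<xi>\<close> that is
  uniformly distributed. Working inside a set \<open>A\<close> with a bound homogeneous in its mass
  avoids conditional measures in the induction.
\<close>
lemma emeasure_undercut_atomless:
  fixes M :: "'b measure" and g :: "'k \<Rightarrow> 'b \<Rightarrow> real" and I :: "'i set"
  assumes M: "prob_space M" and K: "finite K" "\<And>k. k \<in> K \<Longrightarrow> g k \<in> borel_measurable M"
    and atomless: "\<And>k y. k \<in> K \<Longrightarrow> measure M {\<xi> \<in> space M. g k \<xi> = y} = 0"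
    and "finite I" "A \<in> sets M" "0 \<le> \<alpha>" "\<alpha> \<le> measure M A"
  shows "emeasure (PiM I (\<lambda>_. M))
      {\<omega> \<in> space (PiM I (\<lambda>_. M)). (\<forall>i\<in>I. \<omega> i \<in> A) \<and> \<alpha> < measure M (undercut g K I A \<omega>)}
    \<le> ennreal (\<Sum>j<card K. real (card I choose j) * \<alpha> ^ j * (measure M A - \<alpha>) ^ (card I - j))"
  using K atomless assms(5-)
proof (induction K arbitrary: I A \<alpha> rule: finite_induct)
  case empty
  then have "{\<omega> \<in> space (PiM I (\<lambda>_. M)). (\<forall>i\<in>I. \<omega> i \<in> A) \<and> \<alpha> < measure M (undercut g {} I A \<omega>)} = {}"
    by (auto simp: undercut_def)
  then show ?case by (simp only: emeasure_empty zero_le)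
next
  case (insert k0 K)
  interpret prob_space M by fact
  interpret PM: product_prob_space "\<lambda>_::'i. M" by standard
  note [measurable] = \<open>A \<in> sets M\<close> insert.prems(1)[of k0, simplified]
  have gK: "\<And>k. k \<in> insert k0 K \<Longrightarrow> g k \<in> borel_measurable M" by (rule insert.prems(1))
  have finK: "finite (insert k0 K)" using insert.hyps by simp
  note \<alpha> = \<open>0 \<le> \<alpha>\<close> \<open>\<alpha> \<le> measure M A\<close>
  define a where "a = measure M A"
  define n where "n = card I - 1"
  define f1 where "f1 s = (\<Sum>j<card K. real (n choose j) * (\<alpha> - s) ^ j * (a - \<alpha>) ^ (n - j))" for s
  \<comment> \<open>The bound for the other \<open>n\<close> points when the minimising point leaves
    mass \<open>s\<close> below it: the induction hypothesis while \<open>s\<close> is within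
    \<alpha>, otherwise the probability that they all lie above it.\<close>
  define h where "h s = (if s \<le> \<alpha> then ennreal (f1 s) else ennreal ((a - s) ^ n))" for s
  have [measurable]: "f1 \<in> borel_measurable borel" unfolding f1_def by measurable
  have [measurable]: "h \<in> borel_measurable borel" unfolding h_def by measurable
  define p where "p \<xi> = measure M {\<eta> \<in> A. g k0 \<eta> < g k0 \<xi>}" for \<xi>
  define E where "E = {\<omega> \<in> space (PiM I (\<lambda>_. M)). (\<forall>i\<in>I. \<omega> i \<in> A) \<and> \<alpha> < measure M (undercut g (insert k0 K) I A \<omega>)}"
  \<comment> \<open>These events overlap when the minimum is tied; subadditivity suffices.\<close>
  define Ei where "Ei i = {\<omega> \<in> E. \<forall>j\<in>I - {i}. g k0 (\<omega> i) \<le> g k0 (\<omega> j)}" for i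
  have [measurable]: "(\<lambda>\<omega>. measure M (undercut g (insert k0 K) I A \<omega>)) \<in> borel_measurable (PiM I (\<lambda>_. M))"
    by (intro measurable_undercut M finK gK) (use \<open>finite I\<close> in auto)
  have [measurable]: "E \<in> sets (PiM I (\<lambda>_. M))"
    unfolding E_def using \<open>finite I\<close> by measurable
  have Ei_sets[measurable]: "Ei i \<in> sets (PiM I (\<lambda>_. M))" if [simp]: "i \<in> I" for i
  proof -
    have pm: "(\<lambda>\<omega>. g k0 (\<omega> j)) \<in> borel_measurable (PiM I (\<lambda>_. M))" if "j \<in> I" for j
      by (rule measurable_compose[OF measurable_component_singleton[OF that]]) measurable
    have *: "{\<omega> \<in> space (PiM I (\<lambda>_. M)). \<forall>j\<in>I - {i}. g k0 (\<omega> i) \<le> g k0 (\<omega> j)} \<in> sets (PiM I (\<lambda>_. M))"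
      using \<open>finite I\<close> by (intro sets.sets_Collect_finite_All borel_measurable_le pm) auto
    have "Ei i = E \<inter> {\<omega> \<in> space (PiM I (\<lambda>_. M)). \<forall>j\<in>I - {i}. g k0 (\<omega> i) \<le> g k0 (\<omega> j)}"
      by (auto simp: Ei_def E_def)
    also have "\<dots> \<in> sets (PiM I (\<lambda>_. M))" using * by simp
    finally show ?thesis .
  qed
  have card_ins: "card (insert k0 K) = Suc (card K)" using insert.hyps by simp
  have goal: "emeasure (PiM I (\<lambda>_. M)) E \<le> ennreal (\<Sum>j<Suc (card K). real (card I choose j) * \<alpha> ^ j * (a - \<alpha>) ^ (card I - j))"
  proof (cases "I = {}")
    case True
    have "emeasure (PiM I (\<lambda>_. M)) E \<le> 1" by (intro prob_space.emeasure_le_1 prob_space_PiM M)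
    \<comment> \<open>For an empty sample only the term \<open>j = 0\<close> survives, and it equals
      1.\<close>
    also have "(1::ennreal) = ennreal (\<Sum>j<Suc (card K). real (card I choose j) * \<alpha> ^ j * (a - \<alpha>) ^ (card I - j))"
      using True by (simp add: sum.lessThan_Suc_shift del: sum.lessThan_Suc)
    finally show ?thesis .
  next
    case False
    then have cardI: "card I = Suc n" using \<open>finite I\<close> by (simp add: n_def card_gt_0_iff)
    have E_sub: "E \<subseteq> (\<Union>i\<in>I. Ei i)"
    proof
      fix \<omega> assume "\<omega> \<in> E"
      have "\<exists>i\<in>I. \<forall>j\<in>I. g k0 (\<omega> i) \<le> g k0 (\<omega> j)"
        using ex_is_arg_min_if_finite[OF \<open>finite I\<close> False, of "\<lambda>i. g k0 (\<omega> i)"]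
        by (auto simp: is_arg_min_linorder)
      then show "\<omega> \<in> (\<Union>i\<in>I. Ei i)" using \<open>\<omega> \<in> E\<close> by (auto simp: Ei_def)
    qed
    have Ei_le: "emeasure (PiM I (\<lambda>_. M)) (Ei i) \<le> (\<integral>\<^sup>+\<xi>. h (p \<xi>) * indicator A \<xi> \<partial>M)" if i: "i \<in> I" for i
    proof -
      define I' where "I' = I - {i}"
      have I': "finite I'" "i \<notin> I'" "I = insert i I'" "card I' = n"
        using i \<open>finite I\<close> by (auto simp: I'_def n_def)
      interpret P': prob_space "PiM I' (\<lambda>_. M)" by (intro prob_space_PiM M)
      have "emeasure (PiM I (\<lambda>_. M)) (Ei i) = (\<integral>\<^sup>+\<omega>. indicator (Ei i) \<omega> \<partial>PiM (insert i I') (\<lambda>_. M))"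
        using Ei_sets[OF i] I'(3) by simp
      also have "\<dots> = (\<integral>\<^sup>+\<xi>. (\<integral>\<^sup>+\<omega>. indicator (Ei i) (fun_upd \<omega> i \<xi>) \<partial>PiM I' (\<lambda>_. M)) \<partial>M)"
        using Ei_sets[OF i] I' by (intro PM.product_nn_integral_insert_rev) auto
      also have "\<dots> \<le> (\<integral>\<^sup>+\<xi>. h (p \<xi>) * indicator A \<xi> \<partial>M)"
      proof (rule nn_integral_mono)
        fix \<xi> assume \<xi>: "\<xi> \<in> space M"
        show "(\<integral>\<^sup>+\<omega>. indicator (Ei i) (fun_upd \<omega> i \<xi>) \<partial>PiM I' (\<lambda>_. M)) \<le> h (p \<xi>) * indicator A \<xi>"
        proof (cases "\<xi> \<in> A")
          case False
          then have "fun_upd \<omega> i \<xi> \<notin> Ei i" for \<omega> using i by (auto simp: Ei_def E_def)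
          then show ?thesis using False by simp
        next
          case True
          define A' where "A' = {\<eta> \<in> A. g k0 \<xi> \<le> g k0 \<eta>}"
          have A'[measurable]: "A' \<in> sets M" unfolding A'_def by measurable
          define B where "B = {\<eta> \<in> A. g k0 \<eta> < g k0 \<xi>}"
          have B[measurable]: "B \<in> sets M" unfolding B_def by measurable
          have pB: "p \<xi> = measure M B" by (simp add: p_def B_def)
          have "A = A' \<union> B" "A' \<inter> B = {}" by (auto simp: A'_def B_def)
          then have aA': "measure M A' = a - p \<xi>"
            unfolding a_def pB using finite_measure_Union[of A' B] by simp
          \<comment> \<open>The set \<open>B\<close> is undercut through \<open>k0\<close> and uses
            up \<open>p \<xi>\<close> of the allowance \<alpha>. The other points must exceed what
            is left, inside \<open>A'\<close> and through \<open>K\<close> alone.\<close>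
          define E' where "E' = {\<omega> \<in> space (PiM I' (\<lambda>_. M)). (\<forall>j\<in>I'. \<omega> j \<in> A') \<and> \<alpha> - p \<xi> < measure M (undercut g K I' A' \<omega>)}"
          have E'[measurable]: "E' \<in> sets (PiM I' (\<lambda>_. M))"
          proof -
            have [measurable]: "(\<lambda>\<omega>. measure M (undercut g K I' A' \<omega>)) \<in> borel_measurable (PiM I' (\<lambda>_. M))"
              by (intro measurable_undercut M insert.hyps gK) (use I' in auto)
            show ?thesis unfolding E'_def using I'(1) by measurable
          qed
          have sec: "\<omega> \<in> E'" if "\<omega> \<in> space (PiM I' (\<lambda>_. M))" "fun_upd \<omega> i \<xi> \<in> Ei i" for \<omega>
          proof -
            let ?\<omega> = "fun_upd \<omega> i \<xi>"
            have inA: "\<forall>j\<in>I'. \<omega> j \<in> A" and lt: "\<alpha> < measure M (undercut g (insert k0 K) I A ?\<omega>)"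
              and min: "\<forall>j\<in>I'. g k0 \<xi> \<le> g k0 (\<omega> j)"
              using that(2) I'(2,3) by (auto simp: Ei_def E_def split: if_splits) 
            have inA': "\<forall>j\<in>I'. \<omega> j \<in> A'" using inA min by (auto simp: A'_def)
            \<comment> \<open>A point of \<open>A'\<close> does not lie below \<open>\<xi>\<close>
              in coordinate \<open>k0\<close>, so if it undercuts the sample, its witness belongs to
              \<open>K\<close>.\<close>
            have "undercut g (insert k0 K) I A ?\<omega> \<subseteq> B \<union> undercut g K I' A' \<omega>"
              using I'(2) unfolding I'(3) by (auto simp: undercut_def B_def A'_def not_less split: if_splits) 
            then have "measure M (undercut g (insert k0 K) I A ?\<omega>) \<le> measure M (B \<union> undercut g K I' A' \<omega>)"
              by (intro finite_measure_mono sets.Un B undercut_sets insert.hyps I' gK A') auto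
            also have "\<dots> \<le> p \<xi> + measure M (undercut g K I' A' \<omega>)"
              unfolding pB by (intro measure_Un_le B undercut_sets insert.hyps I' gK A') auto
            finally show ?thesis using lt inA' that(1) by (simp add: E'_def)
          qed
          have "(\<integral>\<^sup>+\<omega>. indicator (Ei i) (fun_upd \<omega> i \<xi>) \<partial>PiM I' (\<lambda>_. M)) \<le> (\<integral>\<^sup>+\<omega>. indicator E' \<omega> \<partial>PiM I' (\<lambda>_. M))"
            using sec by (intro nn_integral_mono) (auto split: split_indicator)
          also have "\<dots> = emeasure (PiM I' (\<lambda>_. M)) E'" by simp
          also have "\<dots> \<le> h (p \<xi>)"
          proof (cases "p \<xi> \<le> \<alpha>")
            case True
            \<comment> \<open>Mass and allowance both drop by \<open>p \<xi>\<close>, so their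
              difference is still \<open>a - \<alpha>\<close>; this is the homogeneity that lets the
              induction close.\<close>
            have "emeasure (PiM I' (\<lambda>_. M)) E' \<le> ennreal (\<Sum>j<card K. real (card I' choose j) * (\<alpha> - p \<xi>) ^ j * (measure M A' - (\<alpha> - p \<xi>)) ^ (card I' - j))"
              unfolding E'_def
            proof (rule insert.IH)
              show "\<alpha> - p \<xi> \<le> measure M A'" using \<alpha> by (simp add: aA' a_def)
            qed (use True gK insert.prems(2) I' A' in auto)
            then show ?thesis using True by (simp add: h_def f1_def I'(4) aA')
          next
            case False
            \<comment> \<open>The allowance is already exceeded by \<open>B\<close>, so only
              membership of the other points in \<open>A'\<close> is retained.\<close>
            have "emeasure (PiM I' (\<lambda>_. M)) E' \<le> emeasure (PiM I' (\<lambda>_. M)) (Pi\<^sub>E I' (\<lambda>_. A'))"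
              by (intro emeasure_mono) (auto simp: E'_def space_PiM I' PiE_iff extensional_def sets_PiM_I_finite)
            also have "\<dots> = ennreal ((a - p \<xi>) ^ n)"
              by (simp add: PM.emeasure_PiM I' emeasure_eq_measure aA'[symmetric] ennreal_power)
            finally show ?thesis using False by (simp add: h_def)
          qed
          finally show ?thesis using True by simp
        qed
      qed
      finally show ?thesis .
    qed
    have "emeasure (PiM I (\<lambda>_. M)) E \<le> emeasure (PiM I (\<lambda>_. M)) (\<Union>i\<in>I. Ei i)"
      using \<open>finite I\<close> by (intro emeasure_mono E_sub) auto
    also have "\<dots> \<le> (\<Sum>i\<in>I. emeasure (PiM I (\<lambda>_. M)) (Ei i))"
      using \<open>finite I\<close> by (intro emeasure_subadditive_finite) auto
    also have "\<dots> \<le> (\<Sum>i\<in>I. \<integral>\<^sup>+\<xi>. h (p \<xi>) * indicator A \<xi> \<partial>M)"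
      by (intro sum_mono Ei_le)
    also have "\<dots> = ennreal (real (Suc n)) * (\<integral>\<^sup>+s. h s * indicator {0..a} s \<partial>lborel)"
      unfolding p_def a_def
      by (subst nn_integral_rank[OF M]) (use insert.prems(2) in \<open>auto simp: cardI ennreal_of_nat_eq_real_of_nat\<close>)
    also have "\<dots> \<le> ennreal (\<Sum>j<Suc (card K). real (Suc n choose j) * \<alpha> ^ j * (a - \<alpha>) ^ (Suc n - j))"
      unfolding h_def f1_def using \<alpha> by (intro nn_integral_binomial_split) (auto simp: a_def)
    finally show ?thesis unfolding cardI .
  qed
  show ?case using goal unfolding E_def a_def card_ins .
qed

text \<open>
  Ties are broken by replacing \<open>g k\<close> with \<open>g k + u / (n + 1)\<close> for an independent uniform \<open>u\<close>;
  the original event is the increasing limit of the perturbed ones.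
\<close>
lemma emeasure_undercut_le:
  fixes M :: "'b measure" and g :: "'k \<Rightarrow> 'b \<Rightarrow> real" and I :: "'i set"
  assumes M: "prob_space M" and K: "finite K" "\<And>k. k \<in> K \<Longrightarrow> g k \<in> borel_measurable M"
    and I: "finite I" and \<alpha>: "0 \<le> \<alpha>" "\<alpha> \<le> 1"
  shows "emeasure (PiM I (\<lambda>_. M)) {\<omega> \<in> space (PiM I (\<lambda>_. M)). \<alpha> < measure M (undercut g K I (space M) \<omega>)}
    \<le> ennreal (\<Sum>j<card K. real (card I choose j) * \<alpha> ^ j * (1 - \<alpha>) ^ (card I - j))"
    (is "_ \<le> ?Q")
proof -
  interpret prob_space M by fact
  define U where "U = restrict_space lborel {0..1::real}"
  have spU: "space U = {0..1}" by (simp add: U_def space_restrict_space)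
  have emU: "emeasure U S = emeasure lborel S" if "S \<subseteq> {0..1}" for S
    unfolding U_def using that by (intro emeasure_restrict_space) auto
  interpret U: prob_space U
    by (rule prob_spaceI) (simp add: spU emU)
  interpret MU: pair_prob_space M U ..
  define M' where "M' = M \<Otimes>\<^sub>M U"
  have M': "prob_space M'" unfolding M'_def by (rule MU.P.prob_space_axioms)
  interpret M': prob_space M' by fact
  have spM': "space M' = space M \<times> {0..1}" by (simp add: M'_def space_pair_measure spU)
  have [measurable]: "(\<lambda>u. u) \<in> borel_measurable U"
    unfolding U_def by (intro measurable_restrict_space1) simp
  have snd': "snd \<in> borel_measurable M'"
    using measurable_compose[OF measurable_snd, of "\<lambda>u. u" U borel M] by (simp add: M'_def)
  have [measurable]: "fst \<in> measurable M' M" by (simp add: M'_def)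
  have distr: "distr M' M fst = M" unfolding M'_def by (rule U.distr_pair_fst)
  define e where "e n = inverse (real (Suc n))" for n
  have e0: "e n > 0" for n by (simp add: e_def)
  define g' where "g' n k x = g k (fst x) + snd x * e n" for n k x
  have g'_meas: "g' n k \<in> borel_measurable M'" if "k \<in> K" for n k
  proof -
    note [measurable] = K(2)[OF that] snd'
    show ?thesis unfolding g'_def by measurable
  qed
  have atomless: "measure M' {x \<in> space M'. g' n k x = y} = 0" if k: "k \<in> K" for n k y
  proof -
    note [measurable] = g'_meas[OF k]
    have S: "{x \<in> space M'. g' n k x = y} \<in> sets M'" by measurable
    have "emeasure M' {x \<in> space M'. g' n k x = y} = (\<integral>\<^sup>+\<xi>. emeasure U (Pair \<xi> -` {x \<in> space M'. g' n k x = y}) \<partial>M)"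
      using S unfolding M'_def by (rule U.emeasure_pair_measure_alt)
    \<comment> \<open>For a fixed first component, at most one value of the uniform variable
      produces the value \<open>y\<close>.\<close>
    also have "\<dots> = (\<integral>\<^sup>+\<xi>. 0 \<partial>M)"
    proof (rule nn_integral_cong)
      fix \<xi>
      have "Pair \<xi> -` {x \<in> space M'. g' n k x = y} \<subseteq> {(y - g k \<xi>) / e n}"
        using e0[of n] by (auto simp: g'_def field_simps)
      then have "finite (Pair \<xi> -` {x \<in> space M'. g' n k x = y})" by (rule finite_subset) simp
      moreover have "Pair \<xi> -` {x \<in> space M'. g' n k x = y} \<subseteq> {0..1}" by (auto simp: spM')
      ultimately show "emeasure U (Pair \<xi> -` {x \<in> space M'. g' n k x = y}) = 0"
        by (simp add: emU emeasure_lborel_countable countable_finite)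
    qed
    finally show ?thesis by (simp add: measure_def)
  qed
  \<comment> \<open>The margin \<open>e n\<close> is the largest possible perturbation. A point
    beating the sample by this margin still beats it after perturbation, whatever the uniform
    components are, and \<open>D\<close> itself lives on the original space.\<close>
  define D where "D n \<omega> = {\<eta> \<in> space M. \<exists>k\<in>K. \<forall>i\<in>I. g k \<eta> + e n < g k (\<omega> i)}" for n and \<omega> :: "'i \<Rightarrow> 'b"
  note [measurable] = K(2)
  have D_sets[measurable]: "D n \<omega> \<in> sets M" for n \<omega>
    unfolding D_def using K(1) I by measurable
  have D_meas[measurable]: "(\<lambda>\<omega>. measure M (D n \<omega>)) \<in> borel_measurable (PiM I (\<lambda>_. M))" for n
    unfolding D_def by (intro measurable_exceedance M K I borel_measurable_add) auto
  define S where "S n = {\<omega> \<in> space (PiM I (\<lambda>_. M)). \<alpha> < measure M (D n \<omega>)}" for n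
  have S_sets[measurable]: "S n \<in> sets (PiM I (\<lambda>_. M))" for n unfolding S_def by measurable
  have S_le: "emeasure (PiM I (\<lambda>_. M)) (S n) \<le> ?Q" for n
  proof -
    let ?E = "{\<omega> \<in> space (PiM I (\<lambda>_. M')). (\<forall>i\<in>I. \<omega> i \<in> space M') \<and> \<alpha> < measure M' (undercut (g' n) K I (space M') \<omega>)}"
    have [measurable]: "(\<lambda>\<omega>. measure M' (undercut (g' n) K I (space M') \<omega>)) \<in> borel_measurable (PiM I (\<lambda>_. M'))"
      by (intro measurable_undercut M' K g'_meas I) auto
    have E: "?E \<in> sets (PiM I (\<lambda>_. M'))" using I by measurable
    have cm[measurable]: "compose I fst \<in> measurable (PiM I (\<lambda>_. M')) (PiM I (\<lambda>_. M))"
      unfolding compose_def by measurable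
    \<comment> \<open>Dropping the uniform components of a sample from \<open>M'\<close> yields a
      sample from \<open>M\<close>, so the perturbed bound transfers back.\<close>
    have "PiM I (\<lambda>_. M) = distr (PiM I (\<lambda>_. M')) (PiM I (\<lambda>_. M)) (compose I fst)"
      using distr_PiM_finite_prob_space'[OF I, of "\<lambda>_. M'" "\<lambda>_. M" fst] M M' by (simp add: distr)
    then have "emeasure (PiM I (\<lambda>_. M)) (S n) = emeasure (distr (PiM I (\<lambda>_. M')) (PiM I (\<lambda>_. M)) (compose I fst)) (S n)"
      by simp
    also have "\<dots> = emeasure (PiM I (\<lambda>_. M')) (compose I fst -` S n \<inter> space (PiM I (\<lambda>_. M')))"
      by (rule emeasure_distr) (use S_sets cm in auto)
    also have "\<dots> \<le> emeasure (PiM I (\<lambda>_. M')) ?E"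
    proof (rule emeasure_mono[OF subsetI E])
      fix \<omega> assume "\<omega> \<in> compose I fst -` S n \<inter> space (PiM I (\<lambda>_. M'))"
      then have \<omega>: "\<omega> \<in> space (PiM I (\<lambda>_. M'))" "\<alpha> < measure M (D n (compose I fst \<omega>))"
        by (auto simp: S_def)
      have in': "\<forall>i\<in>I. \<omega> i \<in> space M'" using \<omega>(1) by (auto simp: space_PiM)
      have "D n (compose I fst \<omega>) \<times> space U \<subseteq> undercut (g' n) K I (space M') \<omega>"
      proof
        fix x assume "x \<in> D n (compose I fst \<omega>) \<times> space U"
        then obtain k where k: "k \<in> K" "\<And>i. i \<in> I \<Longrightarrow> g k (fst x) + e n < g k (fst (\<omega> i))"
          and x: "fst x \<in> space M" "0 \<le> snd x" "snd x \<le> 1"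
          by (auto simp: D_def compose_def spU)
        have "g' n k x < g' n k (\<omega> i)" if i: "i \<in> I" for i
        proof -
          have "snd x * e n \<le> 1 * e n" using x e0[of n] by (intro mult_right_mono) auto
          moreover have "0 \<le> snd (\<omega> i) * e n" using in' i e0[of n] by (auto simp: spM' mem_Times_iff)
          ultimately show ?thesis using k(2)[OF i] by (simp add: g'_def)
        qed
        then show "x \<in> undercut (g' n) K I (space M') \<omega>"
          using k(1) x by (auto simp: undercut_def spM' mem_Times_iff)
      qed
      then have "measure M' (D n (compose I fst \<omega>) \<times> space U) \<le> measure M' (undercut (g' n) K I (space M') \<omega>)"
        by (intro M'.finite_measure_mono undercut_sets K g'_meas I) auto
      moreover have "measure M' (D n (compose I fst \<omega>) \<times> space U) = measure M (D n (compose I fst \<omega>))"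
        unfolding M'_def measure_def by (subst U.emeasure_pair_measure_Times) (auto simp: U.emeasure_space_1)
      ultimately show "\<omega> \<in> ?E" using \<omega> in' by simp
    qed
    also have "\<dots> \<le> ennreal (\<Sum>j<card K. real (card I choose j) * \<alpha> ^ j * (measure M' (space M') - \<alpha>) ^ (card I - j))"
      by (intro emeasure_undercut_atomless M' K g'_meas atomless I \<alpha>) (auto simp: M'.prob_space \<alpha>)
    finally show ?thesis by (simp add: M'.prob_space)
  qed
  have e_mono: "m \<le> n \<Longrightarrow> e n \<le> e m" for m n by (auto simp: e_def le_imp_inverse_le)
  have D_mono: "incseq (\<lambda>n. D n \<omega>)" for \<omega>
  proof (rule incseq_SucI, rule subsetI)
    fix n \<eta> assume "\<eta> \<in> D n \<omega>"
    moreover have "e (Suc n) \<le> e n" by (rule e_mono) simp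
    ultimately show "\<eta> \<in> D (Suc n) \<omega>" unfolding D_def by force
  qed
  have D_Un: "(\<Union>n. D n \<omega>) = undercut g K I (space M) \<omega>" for \<omega>
  proof (intro equalityI subsetI)
    fix \<eta> assume "\<eta> \<in> (\<Union>n. D n \<omega>)"
    then obtain n k where *: "\<eta> \<in> space M" "k \<in> K" "\<And>i. i \<in> I \<Longrightarrow> g k \<eta> + e n < g k (\<omega> i)"
      by (auto simp: D_def)
    have "g k \<eta> < g k (\<omega> i)" if "i \<in> I" for i using *(3)[OF that] e0[of n] by linarith
    then show "\<eta> \<in> undercut g K I (space M) \<omega>" using * by (auto simp: undercut_def)
  next
    fix \<eta> assume "\<eta> \<in> undercut g K I (space M) \<omega>"
    then obtain k where *: "\<eta> \<in> space M" "k \<in> K" "\<And>i. i \<in> I \<Longrightarrow> g k \<eta> < g k (\<omega> i)"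
      by (auto simp: undercut_def)
    \<comment> \<open>Finitely many strict inequalities leave a common positive margin, and
      \<open>e n\<close> eventually falls below it.\<close>
    have "\<forall>\<^sub>F n in sequentially. \<forall>i\<in>I. e n < g k (\<omega> i) - g k \<eta>"
      using I
    proof (rule eventually_ball_finite, intro ballI)
      fix i assume "i \<in> I"
      then show "\<forall>\<^sub>F n in sequentially. e n < g k (\<omega> i) - g k \<eta>"
        using LIMSEQ_inverse_real_of_nat *(3)[of i] unfolding e_def by (intro order_tendstoD(2)) auto
    qed
    then obtain n where "\<forall>i\<in>I. e n < g k (\<omega> i) - g k \<eta>" by (auto simp: eventually_sequentially)
    then have "\<forall>i\<in>I. g k \<eta> + e n < g k (\<omega> i)" by (simp add: algebra_simps)
    then have "\<eta> \<in> D n \<omega>" using * by (auto simp: D_def)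
    then show "\<eta> \<in> (\<Union>n. D n \<omega>)" by auto
  qed
  have S_mono: "incseq S"
  proof (rule incseq_SucI, rule subsetI)
    fix n \<omega> assume "\<omega> \<in> S n"
    moreover have "measure M (D n \<omega>) \<le> measure M (D (Suc n) \<omega>)"
      using incseq_SucD[OF D_mono] by (intro finite_measure_mono) auto
    ultimately show "\<omega> \<in> S (Suc n)" by (auto simp: S_def)
  qed
  \<comment> \<open>The strict inequality in the event matters: a limit above \<alpha> is already
    exceeded at some finite stage.\<close>
  have S_Un: "{\<omega> \<in> space (PiM I (\<lambda>_. M)). \<alpha> < measure M (undercut g K I (space M) \<omega>)} \<subseteq> (\<Union>n. S n)"
  proof clarify
    fix \<omega> assume \<omega>: "\<omega> \<in> space (PiM I (\<lambda>_. M))" "\<alpha> < measure M (undercut g K I (space M) \<omega>)"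
    have "(\<lambda>n. measure M (D n \<omega>)) \<longlonglongrightarrow> measure M (\<Union>n. D n \<omega>)"
      using D_mono by (intro finite_Lim_measure_incseq) auto
    then have "\<forall>\<^sub>F n in sequentially. \<alpha> < measure M (D n \<omega>)"
      using \<omega>(2) by (intro order_tendstoD(1)) (auto simp: D_Un)
    then show "\<omega> \<in> (\<Union>n. S n)" using \<omega>(1) by (auto simp: S_def eventually_sequentially)
  qed
  have "emeasure (PiM I (\<lambda>_. M)) {\<omega> \<in> space (PiM I (\<lambda>_. M)). \<alpha> < measure M (undercut g K I (space M) \<omega>)} \<le> emeasure (PiM I (\<lambda>_. M)) (\<Union>n. S n)"
    using S_Un by (intro emeasure_mono) auto
  also have "\<dots> = (SUP n. emeasure (PiM I (\<lambda>_. M)) (S n))"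
    by (rule SUP_emeasure_incseq[symmetric]) (use S_mono in auto)
  also have "\<dots> \<le> ?Q" by (intro SUP_least S_le)
  finally show ?thesis .
qed

section \<open>Chernoff bounds, essential infima and extended expectations\<close>

text \<open>A majorant, independent of \<open>t\<close>, for differentiating the moment generating
  function at 0. The upper estimate is convexity of \<open>exp\<close> between 0 and
  \<open>s * y\<close>; the lower one reduces to it at \<open>- y\<close>, because the sum of
  \<open>exp v\<close> and \<open>exp (- v)\<close> is at least 2.\<close>

lemma abs_exp_minus_one_le:
  fixes t s y :: real
  assumes "0 < t" "t \<le> s"
  shows "\<bar>(exp (t * y) - 1) / t\<bar> \<le> (exp (s * y) + exp (- s * y)) / s"
proof -
  have s: "0 < s" using assms by simp
  have up: "(exp (t * z) - 1) / t \<le> exp (s * z) / s" for z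
  proof -
    have "exp (1 * ((1 - t / s) *\<^sub>R 0 + (t / s) *\<^sub>R (s * z))) \<le> (1 - t / s) * exp (1 * 0) + t / s * exp (1 * (s * z))"
      using assms s by (intro convex_onD[OF convex_on_exp]) auto
    then have "exp (t * z) \<le> (1 - t / s) + t / s * exp (s * z)" using s by simp
    then have "exp (t * z) - 1 \<le> t / s * exp (s * z)" using s assms by (smt (verit) divide_nonneg_pos)
    then have "exp (t * z) - 1 \<le> t * (exp (s * z) / s)"
      using assms by simp
    then show ?thesis using assms by (simp add: divide_le_eq mult.commute)
  qed
  have "- ((exp (t * y) - 1) / t) \<le> (exp (t * (- y)) - 1) / t"
  proof -
    have "2 \<le> exp (t * y) + exp (- (t * y))"
      using exp_ge_add_one_self[of "t * y"] exp_ge_add_one_self[of "- (t * y)"] by linarith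
    then have "- (exp (t * y) - 1) \<le> exp (t * (- y)) - 1" by simp
    then have "(- (exp (t * y) - 1)) / t \<le> (exp (t * (- y)) - 1) / t"
      using assms by (intro divide_right_mono) auto
    then show ?thesis by (simp only: minus_divide_left)
  qed
  also have "\<dots> \<le> exp (- s * y) / s" using up[of "- y"] by simp
  finally have lo: "- ((exp (t * y) - 1) / t) \<le> exp (- s * y) / s" .
  have "0 \<le> exp (s * y) / s" "0 \<le> exp (- s * y) / s" using s by auto
  then show ?thesis
    unfolding abs_le_iff add_divide_distrib using up[of y] lo by linarith
qed

text \<open>The moment generating function equals 1 at 0 and its right derivative there is the
  negative mean, so it drops below 1 at some small positive argument. Dominated convergence of the
  difference quotients along a sequence makes this precise.\<close>

lemma exists_mgf_less_one:
  fixes Y :: "'b \<Rightarrow> real"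
  assumes "prob_space M" and Y: "integrable M Y" "(\<integral>x. Y x \<partial>M) < 0"
    and \<delta>: "\<delta> > 0" and int: "\<And>t. \<bar>t\<bar> < \<delta> \<Longrightarrow> integrable M (\<lambda>x. exp (t * Y x))"
  shows "\<exists>t>0. integrable M (\<lambda>x. exp (t * Y x)) \<and> (\<integral>x. exp (t * Y x) \<partial>M) < 1"
proof -
  interpret prob_space M by fact
  \<comment> \<open>Half of \<delta> keeps both \<open>s\<close> and \<open>- s\<close> inside the
    range where the exponentials are integrable.\<close>
  define s where "s = \<delta> / 2"
  have s: "0 < s" "s < \<delta>" using \<delta> by (auto simp: s_def)
  define t where "t n = s / real (Suc n)" for n
  have t: "0 < t n" "t n \<le> s" for n using s by (auto simp: t_def field_simps)
  have t_lim: "t \<longlonglongrightarrow> 0"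
    unfolding t_def using tendsto_mult_right_zero[OF LIMSEQ_inverse_real_of_nat, of s] by (simp add: field_simps)
  note [measurable] = borel_measurable_integrable[OF Y(1)]
  have intt: "integrable M (\<lambda>x. exp (t n * Y x))" for n
    using t[of n] s by (intro int) auto
  have "(\<lambda>n. \<integral>x. (exp (t n * Y x) - 1) / t n \<partial>M) \<longlonglongrightarrow> (\<integral>x. Y x \<partial>M)"
  proof (rule integral_dominated_convergence[where w="\<lambda>x. (exp (s * Y x) + exp (- s * Y x)) / s"])
    show "integrable M (\<lambda>x. (exp (s * Y x) + exp (- s * Y x)) / s)"
      using s by (intro integrable_divide_zero Bochner_Integration.integrable_add int) auto
    show "AE x in M. (\<lambda>n. (exp (t n * Y x) - 1) / t n) \<longlonglongrightarrow> Y x"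
    proof (rule AE_I2)
      fix x
      have "((\<lambda>u. exp (u * Y x)) has_real_derivative Y x) (at 0)"
        by (auto intro!: derivative_eq_intros)
      then have "((\<lambda>h. (exp (h * Y x) - 1) / h) \<longlongrightarrow> Y x) (at 0)"
        by (simp add: DERIV_def)
      moreover have "filterlim t (at 0) sequentially"
        using t_lim t(1) by (auto simp: filterlim_at eventually_sequentially less_imp_neq[symmetric] intro: exI)
      ultimately show "(\<lambda>n. (exp (t n * Y x) - 1) / t n) \<longlonglongrightarrow> Y x"
        by (rule filterlim_compose)
    qed
    show "AE x in M. norm ((exp (t n * Y x) - 1) / t n) \<le> (exp (s * Y x) + exp (- s * Y x)) / s" for n
      using abs_exp_minus_one_le[OF t] by auto
  qed measurable
  then have "\<forall>\<^sub>F n in sequentially. (\<integral>x. (exp (t n * Y x) - 1) / t n \<partial>M) < 0"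
    using Y(2) by (rule order_tendstoD)
  then obtain n where n: "(\<integral>x. (exp (t n * Y x) - 1) / t n \<partial>M) < 0" by (auto simp: eventually_sequentially)
  have "(\<integral>x. (exp (t n * Y x) - 1) / t n \<partial>M) = ((\<integral>x. exp (t n * Y x) \<partial>M) - 1) / t n"
    using intt[of n] by (simp add: prob_space)
  then have "(\<integral>x. exp (t n * Y x) \<partial>M) < 1" using n t(1)[of n] by (simp add: divide_less_0_iff)
  then show ?thesis using t(1) intt by blast
qed

text \<open>Exponential Markov inequality at one fixed \<open>t\<close> for which the moment
  generating function of \<open>g - b\<close> is below 1; by independence its \<open>N\<close>-th
  power bounds the event. The rate does not depend on \<open>N\<close>, and for \<open>N = 0\<close>
  both event probability and bound are 1.\<close>

lemma chernoff_bound: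
  fixes g :: "'b \<Rightarrow> real"
  assumes "prob_space M" and g: "integrable M g" "(\<integral>x. g x \<partial>M) < b"
    and \<delta>: "\<delta> > 0" and int: "\<And>t. \<bar>t\<bar> < \<delta> \<Longrightarrow> integrable M (\<lambda>x. exp (t * g x))"
  shows "\<exists>\<theta>>0. \<forall>N. measure (PiM {..<N} (\<lambda>_. M))
      {\<omega> \<in> space (PiM {..<N} (\<lambda>_. M)). real N * b \<le> (\<Sum>i<N. g (\<omega> i))} \<le> exp (- real N * \<theta>)"
proof -
  interpret prob_space M by fact
  interpret PM: product_prob_space "\<lambda>_::nat. M" by standard
  define Y where "Y x = g x - b" for x
  note [measurable] = borel_measurable_integrable[OF g(1)]
  have "integrable M (\<lambda>x. exp (t * Y x))" if "\<bar>t\<bar> < \<delta>" for t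
    using integrable_mult_right[OF int[OF that], of "exp (- t * b)"]
    by (simp add: Y_def algebra_simps flip: exp_add)
  moreover have "integrable M Y" "(\<integral>x. Y x \<partial>M) < 0"
    using g by (auto simp: Y_def[abs_def] prob_space)
  ultimately obtain t where t: "t > 0" "integrable M (\<lambda>x. exp (t * Y x))" "(\<integral>x. exp (t * Y x) \<partial>M) < 1"
    using exists_mgf_less_one[OF assms(1) _ _ \<delta>, of Y] by blast
  have [measurable]: "Y \<in> borel_measurable M" by (simp add: Y_def[abs_def])
  \<comment> \<open>The maximum with \<open>1 / 2\<close> keeps \<open>q\<close> positive, so that
    \<open>- ln q\<close> can serve as the rate.\<close>
  define q where "q = max (1 / 2) (\<integral>x. exp (t * Y x) \<partial>M)"
  have q: "0 < q" "q < 1" using t(3) by (auto simp: q_def)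
  show ?thesis
  proof (intro exI[of _ "- ln q"] conjI allI)
    show "0 < - ln q" using q by simp
    fix N :: nat
    let ?P = "PiM {..<N} (\<lambda>_. M)"
    interpret P: prob_space ?P by (intro prob_space_PiM) (rule assms(1))
    let ?E = "{\<omega> \<in> space ?P. real N * b \<le> (\<Sum>i<N. g (\<omega> i))}"
    have "emeasure ?P ?E = (\<integral>\<^sup>+\<omega>. indicator ?E \<omega> \<partial>?P)" by simp
    also have "\<dots> \<le> (\<integral>\<^sup>+\<omega>. (\<Prod>i<N. ennreal (exp (t * Y (\<omega> i)))) \<partial>?P)"
    proof (intro nn_integral_mono)
      fix \<omega>
      have "1 \<le> (\<Prod>i<N. ennreal (exp (t * Y (\<omega> i))))" if "\<omega> \<in> ?E"
      proof -
        have "0 \<le> t * (\<Sum>i<N. Y (\<omega> i))" using that t(1) by (simp add: Y_def sum_subtractf)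
        then have "1 \<le> exp (\<Sum>i<N. t * Y (\<omega> i))" by (simp add: sum_distrib_left)
        then show ?thesis by (simp add: exp_sum prod_ennreal)
      qed
      then show "indicator ?E \<omega> \<le> (\<Prod>i<N. ennreal (exp (t * Y (\<omega> i))))"
        by (cases "\<omega> \<in> ?E") (simp_all only: indicator_def of_bool_eq zero_le simp_thms)
    qed
    also have "\<dots> = (\<Prod>i<N. \<integral>\<^sup>+x. ennreal (exp (t * Y x)) \<partial>M)"
      by (rule PM.product_nn_integral_prod) auto
    also have "\<dots> = ennreal ((\<integral>x. exp (t * Y x) \<partial>M) ^ N)"
      using t(2) by (subst nn_integral_eq_integral) (auto simp: ennreal_power)
    also have "\<dots> \<le> ennreal (q ^ N)"
      by (intro ennreal_leI power_mono integral_nonneg) (auto simp: q_def)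
    finally have "measure ?P ?E \<le> q ^ N" using q by (simp add: P.emeasure_eq_measure)
    also have "q ^ N = exp (- real N * - ln q)" using q by (simp add: exp_of_nat_mult)
    finally show "measure ?P ?E \<le> exp (- real N * - ln q)" .
  qed
qed

text \<open>The lower bound \<open>c0\<close> keeps the quantile above minus infinity, and
  exhaustion of the space by sublevel sets keeps it finite. The last two conclusions characterise
  the essential infimum: no mass below it, positive mass in every right neighbourhood.\<close>

lemma essential_infimum:
  assumes "prob_space M" and [measurable]: "l \<in> borel_measurable M" and lb: "AE x in M. c0 \<le> l x"
  obtains q where "quantile_lvl M l 0 = ereal q" "AE x in M. q \<le> l x"
    "\<And>\<delta>. \<delta> > 0 \<Longrightarrow> 0 < measure M {x \<in> space M. l x \<le> q + \<delta>}"
proof -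
  interpret prob_space M by fact
  define T where "T = {t. 0 < measure M {x \<in> space M. l x \<le> t}}"
  have bdd: "bdd_below T"
  proof (rule bdd_belowI[of _ c0], rule ccontr)
    fix t assume "t \<in> T" "\<not> c0 \<le> t"
    then have "AE x in M. x \<notin> {x \<in> space M. l x \<le> t}" using lb by auto
    then have "measure M {x \<in> space M. l x \<le> t} = 0" by (simp add: prob_eq_0)
    then show False using \<open>t \<in> T\<close> by (simp add: T_def)
  qed
  have "(\<lambda>n. measure M {x \<in> space M. l x \<le> real n}) \<longlonglongrightarrow> measure M (\<Union>n. {x \<in> space M. l x \<le> real n})"
    by (intro finite_Lim_measure_incseq) (auto simp: incseq_def)
  also have "(\<Union>n. {x \<in> space M. l x \<le> real n}) = space M" using real_arch_simple by auto
  finally have "\<forall>\<^sub>F n in sequentially. 0 < measure M {x \<in> space M. l x \<le> real n}"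
    by (intro order_tendstoD(1)) (auto simp: prob_space)
  then have ne: "T \<noteq> {}" by (auto simp: T_def eventually_sequentially)
  define q where "q = Inf T"
  have "quantile_lvl M l 0 = ereal q"
    unfolding quantile_lvl_def T_def[symmetric] q_def by (rule ereal_Inf'[OF bdd ne, symmetric])
  moreover have "AE x in M. q \<le> l x"
  proof -
    have "AE x in M. q - inverse (real (Suc n)) < l x" for n
    proof -
      have "q - inverse (real (Suc n)) \<notin> T"
        using cInf_lower[OF _ bdd] unfolding q_def[symmetric] by (fastforce simp: not_le)
      then have "measure M {x \<in> space M. l x \<le> q - inverse (real (Suc n))} = 0"
        by (simp add: T_def zero_less_measure_iff)
      then have "AE x in M. x \<notin> {x \<in> space M. l x \<le> q - inverse (real (Suc n))}"
        by (subst (asm) prob_eq_0) auto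
      then show ?thesis by (auto simp: not_le)
    qed
    then have "AE x in M. \<forall>n. q - inverse (real (Suc n)) < l x" by (simp add: AE_all_countable)
    then show ?thesis
    proof (rule AE_mp, intro AE_I2 impI)
      fix x assume *: "\<forall>n. q - inverse (real (Suc n)) < l x"
      have "(\<lambda>n. q - inverse (real (Suc n))) \<longlonglongrightarrow> q - 0"
        by (intro tendsto_intros LIMSEQ_inverse_real_of_nat)
      then show "q \<le> l x" using * by (intro LIMSEQ_le_const2[of _ q]) (auto intro: less_imp_le)
    qed
  qed
  moreover have "0 < measure M {x \<in> space M. l x \<le> q + \<delta>}" if \<delta>: "\<delta> > 0" for \<delta>
  proof -
    obtain t where "t \<in> T" "t < q + \<delta>"
      using cInf_lessD[OF ne, of "q + \<delta>"] \<delta> unfolding q_def by auto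
    then have "0 < measure M {x \<in> space M. l x \<le> t}" by (simp add: T_def)
    also have "\<dots> \<le> measure M {x \<in> space M. l x \<le> q + \<delta>}"
      using \<open>t < q + \<delta>\<close> by (intro finite_measure_mono) auto
    finally show ?thesis .
  qed
  ultimately show ?thesis by (rule that)
qed

text \<open>A finite value forces both the positive and the negative part to have finite integral.
  The value 0 that \<open>real_of_ereal\<close> assigns to infinities then matters only on a null
  set.\<close>

lemma expect_ext_finite:
  assumes [measurable]: "g \<in> borel_measurable M" and "- \<infinity> < expect_ext M g" "expect_ext M g < \<infinity>"
  shows "AE x in M. \<bar>g x\<bar> \<noteq> \<infinity>" "integrable M (\<lambda>x. real_of_ereal (g x))"
    "expect_ext M g = ereal (\<integral>x. real_of_ereal (g x) \<partial>M)"
proof -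
  let ?p = "\<integral>\<^sup>+ x. e2ennreal (g x) \<partial>M" and ?n = "\<integral>\<^sup>+ x. e2ennreal (- g x) \<partial>M"
  have n: "?n \<noteq> \<infinity>" using assms(2) by (auto simp: expect_ext_def)
  then have e: "expect_ext M g = enn2ereal ?p - enn2ereal ?n" by (simp add: expect_ext_def)
  have p: "?p \<noteq> \<infinity>" using assms(3) n unfolding e by (cases ?n) auto
  have AEp: "AE x in M. e2ennreal (g x) \<noteq> \<infinity>" using p by (intro nn_integral_PInf_AE) auto
  have AEn: "AE x in M. e2ennreal (- g x) \<noteq> \<infinity>" using n by (intro nn_integral_PInf_AE) auto
  show fin: "AE x in M. \<bar>g x\<bar> \<noteq> \<infinity>"
    using AEp AEn by eventually_elim (auto simp: abs_ereal.simps e2ennreal_infty)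
  have "(\<integral>\<^sup>+ x. ennreal (real_of_ereal (g x)) \<partial>M) = ?p"
    using fin by (intro nn_integral_cong_AE, eventually_elim) (auto simp: e2ennreal_ereal)
  moreover have "(\<integral>\<^sup>+ x. ennreal (- real_of_ereal (g x)) \<partial>M) = ?n"
    using fin by (intro nn_integral_cong_AE, eventually_elim) (auto simp: e2ennreal_ereal)
  ultimately show int: "integrable M (\<lambda>x. real_of_ereal (g x))"
    and "expect_ext M g = ereal (\<integral>x. real_of_ereal (g x) \<partial>M)"
    using p n unfolding e
    by (auto simp: real_integrable_def real_lebesgue_integral_def) (cases ?p; cases ?n; simp)
qed

lemma expect_ext_less_top:
  assumes "AE x in M. g x \<le> ereal (u x)" "integrable M u" "- \<infinity> < expect_ext M g"
  shows "expect_ext M g < \<infinity>"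
proof -
  let ?p = "\<integral>\<^sup>+ x. e2ennreal (g x) \<partial>M" and ?n = "\<integral>\<^sup>+ x. e2ennreal (- g x) \<partial>M"
  have n: "?n \<noteq> \<infinity>" using assms(3) by (auto simp: expect_ext_def)
  have "?p \<le> (\<integral>\<^sup>+ x. ennreal (u x) \<partial>M)"
    using assms(1) by (intro nn_integral_mono_AE, eventually_elim) (metis e2ennreal_ereal e2ennreal_mono)
  also have "\<dots> < \<infinity>" using assms(2) by (simp add: real_integrable_def less_top)
  finally show ?thesis using n unfolding expect_ext_def by (cases ?p; cases ?n) auto
qed

section \<open>Compactness and convexity\<close>

text \<open>Sample-feasible points satisfy the constraints defining the domain of \<open>F\<close>
  only up to some slack, yet must be compared with points that satisfy them exactly. Outside the
  balls around a net of the exactly feasible points, the total violation is positive on a compact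
  set, hence bounded below; a small enough slack per constraint cannot reach that bound.\<close>

lemma finite_net_of_relaxation:
  fixes c :: "'k \<Rightarrow> 'a::metric_space \<Rightarrow> real"
  assumes "compact S" "finite I" "\<And>k. k \<in> I \<Longrightarrow> continuous_on UNIV (c k)" "0 < \<eta>"
  obtains Z \<delta> where "finite Z" "Z \<subseteq> S" "\<forall>z\<in>Z. \<forall>k\<in>I. c k z \<le> q k" "0 < \<delta>"
    "\<forall>y\<in>S. (\<forall>k\<in>I. c k y \<le> q k + \<delta>) \<longrightarrow> (\<exists>z\<in>Z. dist y z < \<eta>)"
proof -
  define K where "K = S \<inter> (\<Inter>k\<in>I. {z. c k z \<le> q k})"
  have "closed (\<Inter>k\<in>I. {z. c k z \<le> q k})"
    using assms(3) by (intro closed_INT ballI closed_Collect_le continuous_on_const)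
  then have "compact K" unfolding K_def using \<open>compact S\<close> by (rule compact_Int_closed[rotated])
  moreover have "K \<subseteq> (\<Union>z\<in>K. ball z \<eta>)" using \<open>0 < \<eta>\<close> by auto
  ultimately obtain Z where Z: "Z \<subseteq> K" "finite Z" "K \<subseteq> (\<Union>z\<in>Z. ball z \<eta>)"
    by (elim compactE_image[where f="\<lambda>z. ball z \<eta>"]) auto
  define h where "h y = (\<Sum>k\<in>I. max 0 (c k y - q k))" for y
  define R where "R = S - (\<Union>z\<in>Z. ball z \<eta>)"
  have R: "compact R" unfolding R_def by (intro compact_diff \<open>compact S\<close> open_UN) auto
  have "continuous_on UNIV h" unfolding h_def using assms(3) by (intro continuous_intros)
  then have conth: "continuous_on R h" by (rule continuous_on_subset) simp
  have hpos: "0 < h y" if y: "y \<in> R" for y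
  proof -
    have "y \<notin> K" using y Z(3) by (auto simp: R_def)
    then obtain k where "k \<in> I" "q k < c k y" using y by (auto simp: K_def R_def not_le)
    then show ?thesis unfolding h_def using \<open>finite I\<close> by (intro sum_pos2[of _ k]) auto
  qed
  obtain h0 where h0: "0 < h0" "\<And>y. y \<in> R \<Longrightarrow> h0 \<le> h y"
  proof (cases "R = {}")
    case True
    then show ?thesis by (intro that[of 1]) auto
  next
    case False
    then obtain r where "r \<in> R" "\<forall>y\<in>R. h r \<le> h y" using continuous_attains_inf[OF R _ conth] by auto
    then show ?thesis using hpos by (intro that[of "h r"]) auto
  qed
  \<comment> \<open>The additional 1 keeps the sum of \<open>card I\<close> slacks strictly below
    \<open>h0\<close>, also for empty \<open>I\<close>.\<close>
  define \<delta> where "\<delta> = h0 / (card I + 1)"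
  have \<delta>: "0 < \<delta>" using h0 by (simp add: \<delta>_def)
  show ?thesis
  proof (rule that, safe)
    fix y assume y: "y \<in> S" "\<forall>k\<in>I. c k y \<le> q k + \<delta>"
    show "\<exists>z\<in>Z. dist y z < \<eta>"
    proof (rule ccontr)
      assume "\<not> ?thesis"
      then have "y \<in> R" using y(1) by (auto simp: R_def dist_commute)
      then have "h0 \<le> h y" by (rule h0)
      also have "\<dots> \<le> (\<Sum>k\<in>I. \<delta>)" unfolding h_def using y(2) \<delta> by (intro sum_mono) (auto simp: algebra_simps)
      also have "\<dots> < \<delta> * (card I + 1)" using \<delta> by (simp add: algebra_simps)
      also have "\<dots> = h0" by (simp add: \<delta>_def)
      finally show False by simp
    qed
  qed (use Z \<delta> in \<open>auto simp: K_def\<close>)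
qed

lemma segment_crosses_infdist_level:
  fixes a x :: "'a::real_normed_vector"
  assumes "a \<in> A" "0 < \<epsilon>" "\<epsilon> \<le> infdist x A"
  obtains t where "0 \<le> t" "t \<le> 1" "infdist ((1 - t) *\<^sub>R a + t *\<^sub>R x) A = \<epsilon>"
proof -
  have "\<exists>t\<ge>0. t \<le> 1 \<and> infdist ((1 - t) *\<^sub>R a + t *\<^sub>R x) A = \<epsilon>"
    using assms by (intro IVT') (auto intro!: continuous_intros)
  then show ?thesis using that by blast
qed

section \<open>Sample average approximation\<close>

lemma exponential_union_bound:
  assumes P: "\<And>N::nat. prob_space (P N)" and "finite T"
    and E: "\<And>N \<tau>. \<tau> \<in> T \<Longrightarrow> E N \<tau> \<in> sets (P N)"
    and "\<And>\<tau>. \<tau> \<in> T \<Longrightarrow> \<exists>\<theta>>0. \<forall>N. measure (P N) (E N \<tau>) \<le> exp (- real N * \<theta>)"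
  shows "\<exists>\<theta>>0. \<forall>N. measure (P N) (\<Union>\<tau>\<in>T. E N \<tau>) \<le> real (card T) * exp (- real N * \<theta>)"
proof -
  obtain \<theta> where \<theta>: "\<And>\<tau>. \<tau> \<in> T \<Longrightarrow> \<theta> \<tau> > 0" "\<And>\<tau> N. \<tau> \<in> T \<Longrightarrow> measure (P N) (E N \<tau>) \<le> exp (- real N * \<theta> \<tau>)"
    using assms(4) by metis
  \<comment> \<open>Inserting 1 makes the minimum meaningful when \<open>T\<close> is empty.\<close>
  define \<theta>0 where "\<theta>0 = Min (insert 1 (\<theta> ` T))"
  have "\<theta>0 > 0" using \<open>finite T\<close> \<theta>(1) by (simp add: \<theta>0_def)
  moreover have "measure (P N) (\<Union>\<tau>\<in>T. E N \<tau>) \<le> real (card T) * exp (- real N * \<theta>0)" for N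
  proof -
    interpret prob_space "P N" by (rule P)
    have "measure (P N) (\<Union>\<tau>\<in>T. E N \<tau>) \<le> (\<Sum>\<tau>\<in>T. measure (P N) (E N \<tau>))"
      using \<open>finite T\<close> E by (intro finite_measure_subadditive_finite) auto
    also have "\<dots> \<le> (\<Sum>\<tau>\<in>T. exp (- real N * \<theta>0))"
    proof (rule sum_mono)
      fix \<tau> assume \<tau>: "\<tau> \<in> T"
      have "\<theta>0 \<le> \<theta> \<tau>" using \<tau> \<open>finite T\<close> by (simp add: \<theta>0_def)
      then have "exp (- real N * \<theta> \<tau>) \<le> exp (- real N * \<theta>0)" by (simp add: mult_left_mono)
      then show "measure (P N) (E N \<tau>) \<le> exp (- real N * \<theta>0)" using \<theta>(2)[OF \<tau>, of N] by linarith
    qed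
    finally show ?thesis by simp
  qed
  ultimately show ?thesis by blast
qed

lemma saa_eq_ereal:
  assumes "\<And>i. i < N \<Longrightarrow> f (\<omega> i) x \<noteq> - \<infinity>" "\<And>i. i < N \<Longrightarrow> f (\<omega> i) x < \<infinity>"
  shows "saa f N \<omega> x = ereal ((\<Sum>i<N. real_of_ereal (f (\<omega> i) x)) / real N)"
proof -
  have "f (\<omega> i) x = ereal (real_of_ereal (f (\<omega> i) x))" if "i < N" for i
    using assms[OF that] by (cases "f (\<omega> i) x") auto
  then have "(\<Sum>i<N. f (\<omega> i) x) = (\<Sum>i<N. ereal (real_of_ereal (f (\<omega> i) x)))"
    by (intro sum.cong) auto
  then show ?thesis by (simp add: saa_def)
qed

lemma saa_finite_imp_finite:
  assumes "i < N" "saa f N \<omega> x < \<infinity>"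
  shows "f (\<omega> i) x < \<infinity>"
proof (rule ccontr)
  assume "\<not> ?thesis"
  then have "(\<Sum>i<N. f (\<omega> i) x) = \<infinity>" using assms(1) by (auto simp: sum_Pinfty)
  then show False using assms by (simp add: saa_def)
qed

lemma outer_prob_le: "B \<in> sets M \<Longrightarrow> A \<subseteq> B \<Longrightarrow> outer_prob M A \<le> measure M B"
  unfolding outer_prob_def by (rule cInf_lower) (auto intro!: bdd_belowI[of _ 0])

section \<open>The stochastic program and the domain of its objective\<close>

text \<open>The map \<open>xs\<close> is an arbitrary choice of minimisers with no measurability in
  the sample, which is why the result is phrased with \<open>outer_prob\<close>.\<close>

locale saa_problem = prob_space M
  for M :: "'b measure" +
  fixes f :: "'b \<Rightarrow> 'a::euclidean_space \<Rightarrow> ereal"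
    and X :: "'a set" and m :: nat and c :: "nat \<Rightarrow> 'a \<Rightarrow> real" and ell :: "nat \<Rightarrow> 'b \<Rightarrow> real"
    and \<kappa> :: "'b \<Rightarrow> real" and xs :: "nat \<Rightarrow> (nat \<Rightarrow> 'b) \<Rightarrow> 'a"
  assumes X_closed: "closed X" and X_convex: "convex X"
    and f_meas: "\<And>x. (\<lambda>\<xi>. f \<xi> x) \<in> borel_measurable M"
    and f_not_minf: "\<And>\<xi> x. \<xi> \<in> space M \<Longrightarrow> f \<xi> x \<noteq> -\<infinity>"
    and f_convex: "\<And>\<xi>. \<xi> \<in> space M \<Longrightarrow> convex_ext (f \<xi>)"
    and F_gt: "\<And>x. Fobj M f x > -\<infinity>"
    and F_fin: "\<exists>x\<in>X. Fobj M f x < \<infinity>"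
    and Xstar_ne: "opt_set M f X \<noteq> {}" and Xstar_compact: "compact (opt_set M f X)"
    and dom_f: "\<And>\<xi>. \<xi> \<in> space M \<Longrightarrow>
        {x. f \<xi> x < \<infinity>} = {x. \<forall>k\<in>{1..m}. c k x \<le> ell k \<xi>}"
    and c_convex: "\<And>k. k \<in> {1..m} \<Longrightarrow> convex_on UNIV (c k)"
    and ell_meas: "\<And>k. k \<in> {1..m} \<Longrightarrow> ell k \<in> borel_measurable M"
    and \<kappa>_nonneg: "\<And>\<xi>. \<xi> \<in> space M \<Longrightarrow> \<kappa> \<xi> \<ge> 0"
    and \<kappa>_int: "integrable M \<kappa>"
    and lip: "\<And>\<xi>. \<xi> \<in> space M \<Longrightarrow>
        lipschitz_on (\<kappa> \<xi>) {x. f \<xi> x < \<infinity>} (\<lambda>x. real_of_ereal (f \<xi> x))"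
    and C1C3: "\<And>K. compact K \<Longrightarrow> K \<subseteq> {x. Fobj M f x < \<infinity>} \<Longrightarrow>
        (\<forall>x\<in>K. \<exists>\<delta>>0. \<forall>t. \<bar>t\<bar> < \<delta> \<longrightarrow>
            integrable M (\<lambda>\<xi>. exp (t * (real_of_ereal (f \<xi> x) - real_of_ereal (Fobj M f x)))))
        \<and> (\<exists>\<delta>>0. \<forall>t. \<bar>t\<bar> < \<delta> \<longrightarrow> integrable M (\<lambda>\<xi>. exp (t * \<kappa> \<xi>)))"
    and xs_opt: "\<And>N \<omega>. \<omega> \<in> space (PiM {..<N} (\<lambda>_. M)) \<Longrightarrow>
        xs N \<omega> \<in> X \<and> (\<forall>y\<in>X. saa f N \<omega> (xs N \<omega>) \<le> saa f N \<omega> y)"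
begin

abbreviation fr :: "'b \<Rightarrow> 'a \<Rightarrow> real" where "fr \<xi> x \<equiv> real_of_ereal (f \<xi> x)"
abbreviation Fr :: "'a \<Rightarrow> real" where "Fr x \<equiv> real_of_ereal (Fobj M f x)"
abbreviation sample :: "nat \<Rightarrow> (nat \<Rightarrow> 'b) measure" where "sample N \<equiv> PiM {..<N} (\<lambda>_. M)"

lemma dom_iff: "\<xi> \<in> space M \<Longrightarrow> f \<xi> x < \<infinity> \<longleftrightarrow> (\<forall>k\<in>{1..m}. c k x \<le> ell k \<xi>)"
  using dom_f by blast

lemma F_finite:
  assumes "Fobj M f x < \<infinity>"
  shows "AE \<xi> in M. f \<xi> x < \<infinity>" "integrable M (\<lambda>\<xi>. fr \<xi> x)" "Fobj M f x = ereal (\<integral>\<xi>. fr \<xi> x \<partial>M)"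
    "Fr x = (\<integral>\<xi>. fr \<xi> x \<partial>M)"
proof -
  note * = expect_ext_finite[OF f_meas, of x, folded Fobj_def, OF F_gt assms]
  show "AE \<xi> in M. f \<xi> x < \<infinity>" using *(1) by eventually_elim auto
  show "integrable M (\<lambda>\<xi>. fr \<xi> x)" by (rule *(2))
  show "Fobj M f x = ereal (\<integral>\<xi>. fr \<xi> x \<partial>M)" "Fr x = (\<integral>\<xi>. fr \<xi> x \<partial>M)" using *(3) by auto
qed

lemma F_finite_imp_AE_feasible:
  assumes "Fobj M f x < \<infinity>" "k \<in> {1..m}"
  shows "AE \<xi> in M. c k x \<le> ell k \<xi>"
  using F_finite(1)[OF assms(1)] AE_space by eventually_elim (use dom_iff assms(2) in blast)

text \<open>The essential infimum as a real number. \<open>real_of_ereal\<close> would turn an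
  infinite value into 0, so \<open>q k\<close> is meaningful only where \<open>ess_inf_ell\<close>
  shows finiteness.\<close>

definition q :: "nat \<Rightarrow> real" where "q k = real_of_ereal (quantile_lvl M (ell k) 0)"

text \<open>Any point where \<open>F\<close> is finite is almost surely feasible, so its value under
  \<open>c k\<close> is the almost sure lower bound on \<open>ell k\<close> that makes the essential
  infimum finite.\<close>

lemma ess_inf_ell:
  assumes k: "k \<in> {1..m}"
  shows "quantile_lvl M (ell k) 0 = ereal (q k)" "AE \<xi> in M. q k \<le> ell k \<xi>"
    "\<And>\<delta>. \<delta> > 0 \<Longrightarrow> 0 < measure M {\<xi> \<in> space M. ell k \<xi> \<le> q k + \<delta>}"
proof -
  obtain x0 where "Fobj M f x0 < \<infinity>" using F_fin by auto
  then obtain q' where "quantile_lvl M (ell k) 0 = ereal q'" "AE x in M. q' \<le> ell k x"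
      "\<And>\<delta>. \<delta> > 0 \<Longrightarrow> 0 < measure M {x \<in> space M. ell k x \<le> q' + \<delta>}"
    using essential_infimum[OF prob_space_axioms ell_meas[OF k] F_finite_imp_AE_feasible[OF _ k]] by blast
  moreover from this have "q' = q k" by (simp add: q_def)
  ultimately show "quantile_lvl M (ell k) 0 = ereal (q k)" "AE \<xi> in M. q k \<le> ell k \<xi>"
    "\<And>\<delta>. \<delta> > 0 \<Longrightarrow> 0 < measure M {\<xi> \<in> space M. ell k \<xi> \<le> q k + \<delta>}" by auto
qed

text \<open>If \<open>c k x\<close> exceeds \<open>q k\<close>, then \<open>ell k\<close> lies below
  \<open>c k x\<close> with positive probability and \<open>f\<close> is infinite there. Conversely,
  a point satisfying all these inequalities is almost surely feasible, and the Lipschitz bound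
  against a point \<open>x0\<close> of finite value, with \<kappa> integrable, controls its
  expectation.\<close>

lemma F_finite_iff: "Fobj M f x < \<infinity> \<longleftrightarrow> (\<forall>k\<in>{1..m}. c k x \<le> q k)"
proof (intro iffI ballI)
  fix k assume fin: "Fobj M f x < \<infinity>" and k: "k \<in> {1..m}"
  show "c k x \<le> q k"
  proof (rule ccontr)
    assume "\<not> c k x \<le> q k"
    define \<delta> where "\<delta> = (c k x - q k) / 2"
    have \<delta>: "\<delta> > 0" "q k + \<delta> < c k x" using \<open>\<not> c k x \<le> q k\<close> by (auto simp: \<delta>_def field_simps)
    note [measurable] = ell_meas[OF k]
    have "AE \<xi> in M. \<xi> \<notin> {\<xi> \<in> space M. ell k \<xi> \<le> q k + \<delta>}"
      using F_finite_imp_AE_feasible[OF fin k] by (rule eventually_mono) (use \<delta>(2) in auto)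
    then have "measure M {\<xi> \<in> space M. ell k \<xi> \<le> q k + \<delta>} = 0" by (simp add: prob_eq_0)
    then show False using ess_inf_ell(3)[OF k \<delta>(1)] by simp
  qed
next
  assume x: "\<forall>k\<in>{1..m}. c k x \<le> q k"
  obtain x0 where x0: "Fobj M f x0 < \<infinity>" using F_fin by auto
  have "AE \<xi> in M. \<forall>k\<in>{1..m}. q k \<le> ell k \<xi>" by (intro AE_ball_countable' ess_inf_ell(2)) auto
  then have "AE \<xi> in M. f \<xi> x \<le> ereal (\<bar>fr \<xi> x0\<bar> + \<kappa> \<xi> * dist x x0)"
    using F_finite(1)[OF x0] AE_space
  proof eventually_elim
    case (elim \<xi>)
    then have fin: "f \<xi> x < \<infinity>" using x dom_iff by (meson order_trans)
    have "dist (fr \<xi> x) (fr \<xi> x0) \<le> \<kappa> \<xi> * dist x x0"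
      using lipschitz_onD[OF lip[OF elim(3)], of x x0] fin elim(2) by simp
    then have "fr \<xi> x \<le> \<bar>fr \<xi> x0\<bar> + \<kappa> \<xi> * dist x x0" unfolding dist_real_def by linarith
    then show ?case using fin f_not_minf[OF elim(3), of x] by (cases "f \<xi> x") auto
  qed
  then show "Fobj M f x < \<infinity>"
    unfolding Fobj_def
  proof (rule expect_ext_less_top)
    show "integrable M (\<lambda>\<xi>. \<bar>fr \<xi> x0\<bar> + \<kappa> \<xi> * dist x x0)"
      by (intro Bochner_Integration.integrable_add integrable_abs integrable_mult_left F_finite(2)[OF x0] \<kappa>_int)
    show "- \<infinity> < expect_ext M (\<lambda>\<xi>. f \<xi> x)" using F_gt[of x] by (simp only: Fobj_def)
  qed
qed

lemma c_continuous: "k \<in> {1..m} \<Longrightarrow> continuous_on UNIV (c k)"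
  using convex_on_continuous[OF open_UNIV c_convex] .

lemma Fr_lipschitz: "(\<integral>\<xi>. \<kappa> \<xi> \<partial>M)-lipschitz_on {x. Fobj M f x < \<infinity>} Fr"
proof (rule lipschitz_onI)
  show "0 \<le> (\<integral>\<xi>. \<kappa> \<xi> \<partial>M)" using \<kappa>_nonneg by (intro Bochner_Integration.integral_nonneg) auto
  fix x y assume "x \<in> {x. Fobj M f x < \<infinity>}" "y \<in> {x. Fobj M f x < \<infinity>}"
  then have xy: "Fobj M f x < \<infinity>" "Fobj M f y < \<infinity>" by auto
  have "dist (Fr x) (Fr y) = \<bar>\<integral>\<xi>. fr \<xi> x - fr \<xi> y \<partial>M\<bar>"
    using xy by (simp add: F_finite dist_real_def)
  also have "\<dots> \<le> (\<integral>\<xi>. \<bar>fr \<xi> x - fr \<xi> y\<bar> \<partial>M)" by (rule integral_abs_bound)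
  also have "\<dots> \<le> (\<integral>\<xi>. \<kappa> \<xi> * dist x y \<partial>M)"
  proof (rule integral_mono_AE)
    show "AE \<xi> in M. \<bar>fr \<xi> x - fr \<xi> y\<bar> \<le> \<kappa> \<xi> * dist x y"
      using F_finite(1)[OF xy(1)] F_finite(1)[OF xy(2)] AE_space
    proof eventually_elim
      case (elim \<xi>)
      then show ?case using lipschitz_onD[OF lip[OF elim(3)], of x y] by (simp add: dist_real_def)
    qed
  qed (use xy F_finite(2) \<kappa>_int in auto)
  finally show "dist (Fr x) (Fr y) \<le> (\<integral>\<xi>. \<kappa> \<xi> \<partial>M) * dist x y" by simp
qed

lemma opt_set_finite:
  assumes "x \<in> opt_set M f X"
  shows "Fobj M f x < \<infinity>"
proof -
  obtain x0 where x0: "x0 \<in> X" "Fobj M f x0 < \<infinity>" using F_fin by auto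
  have "Fobj M f x \<le> Fobj M f x0" using assms x0(1) by (auto simp: opt_set_def intro: INF_lower)
  then show ?thesis using x0(2) by (rule le_less_trans)
qed

lemma not_optimal_imp_greater:
  assumes "xb \<in> opt_set M f X" "x \<in> X" "x \<notin> opt_set M f X" "Fobj M f x < \<infinity>"
  shows "Fr xb < Fr x"
proof -
  have "Fobj M f xb \<le> Fobj M f x" "Fobj M f x \<noteq> Fobj M f xb"
    using assms(1-3) by (auto simp: opt_set_def intro: INF_lower)
  then show ?thesis using F_finite(3)[OF assms(4)] F_finite(3)[OF opt_set_finite[OF assms(1)]] by simp
qed

section \<open>Exponential tails of the sample averages\<close>

lemma chernoff_f:
  assumes x: "Fobj M f x < \<infinity>" and "0 < \<gamma>"
  shows "\<exists>\<theta>>0. \<forall>N. measure (sample N) {\<omega> \<in> space (sample N). real N * \<gamma> \<le> (\<Sum>i<N. fr (\<omega> i) x - Fr x)} \<le> exp (- real N * \<theta>)"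
    and "\<exists>\<theta>>0. \<forall>N. measure (sample N) {\<omega> \<in> space (sample N). real N * \<gamma> \<le> (\<Sum>i<N. Fr x - fr (\<omega> i) x)} \<le> exp (- real N * \<theta>)"
proof -
  obtain \<delta> where \<delta>: "\<delta> > 0" "\<And>t. \<bar>t\<bar> < \<delta> \<Longrightarrow> integrable M (\<lambda>\<xi>. exp (t * (fr \<xi> x - Fr x)))"
    using C1C3[of "{x}"] x by auto
  have int: "integrable M (\<lambda>\<xi>. fr \<xi> x)" by (rule F_finite(2)[OF x])
  show "\<exists>\<theta>>0. \<forall>N. measure (sample N) {\<omega> \<in> space (sample N). real N * \<gamma> \<le> (\<Sum>i<N. fr (\<omega> i) x - Fr x)} \<le> exp (- real N * \<theta>)"
    using int \<open>0 < \<gamma>\<close> F_finite(4)[OF x] 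
    by (intro chernoff_bound[OF prob_space_axioms _ _ \<delta>]) (auto simp: prob_space)
  have "integrable M (\<lambda>\<xi>. exp (t * (Fr x - fr \<xi> x)))" if "\<bar>t\<bar> < \<delta>" for t
    using \<delta>(2)[of "- t"] that by (simp add: algebra_simps)
  then show "\<exists>\<theta>>0. \<forall>N. measure (sample N) {\<omega> \<in> space (sample N). real N * \<gamma> \<le> (\<Sum>i<N. Fr x - fr (\<omega> i) x)} \<le> exp (- real N * \<theta>)"
    using int \<open>0 < \<gamma>\<close> F_finite(4)[OF x] 
    by (intro chernoff_bound[OF prob_space_axioms _ _ \<delta>(1)]) (auto simp: prob_space)
qed

lemma chernoff_kappa:
  "\<exists>\<theta>>0. \<forall>N. measure (sample N) {\<omega> \<in> space (sample N). real N * ((\<integral>\<xi>. \<kappa> \<xi> \<partial>M) + 1) \<le> (\<Sum>i<N. \<kappa> (\<omega> i))} \<le> exp (- real N * \<theta>)"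
proof -
  \<comment> \<open>The moment condition on \<kappa> does not refer to the points of the compact
    set, so it can be read off at the empty set.\<close>
  obtain \<delta> where \<delta>: "\<delta> > 0" "\<And>t. \<bar>t\<bar> < \<delta> \<Longrightarrow> integrable M (\<lambda>\<xi>. exp (t * \<kappa> \<xi>))"
    using C1C3[of "{}"] by auto
  show ?thesis by (intro chernoff_bound[OF prob_space_axioms \<kappa>_int _ \<delta>]) auto
qed

text \<open>The event says that every sample point lies in \<open>A\<close>. Writing it as a large
  sample sum gives it the same shape as the other exceptional events.\<close>

lemma chernoff_indicator:
  assumes [measurable]: "A \<in> sets M" and "measure M A < 1"
  shows "\<exists>\<theta>>0. \<forall>N. measure (sample N) {\<omega> \<in> space (sample N). real N * 1 \<le> (\<Sum>i<N. indicator A (\<omega> i))} \<le> exp (- real N * \<theta>)"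
proof (rule chernoff_bound[OF prob_space_axioms, where \<delta>=1])
  show "integrable M (\<lambda>\<xi>. exp (t * indicator A \<xi>))" for t :: real
    by (rule integrable_const_bound[where B="exp \<bar>t\<bar>"]) (auto split: split_indicator)
qed (use assms integrable_const_bound[of "indicator A :: _ \<Rightarrow> real" 1] in auto)

abbreviation active :: "nat set" where
  "active \<equiv> {k \<in> {1..m}. \<exists>x\<in>opt_set M f X. ereal (c k x) = quantile_lvl M (ell k) 0}"

section \<open>Localisation of sample solutions near the optimal set\<close>

text \<open>By the choice of \<open>active\<close>, the remaining constraints are strict on the
  whole optimal set. Continuity makes the strict region open, and compactness yields a uniform
  radius.\<close>

lemma inactive_strict_near_opt_set:
  obtains \<epsilon> where "0 < \<epsilon>" "\<forall>x. infdist x (opt_set M f X) < \<epsilon> \<longrightarrow> (\<forall>k\<in>{1..m} - active. c k x < q k)"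
proof -
  define U where "U = (\<Inter>k\<in>{1..m} - active. {x. c k x < q k})"
  have "open U" unfolding U_def
    by (intro open_INT ballI open_Collect_less c_continuous continuous_on_const) auto
  moreover have "opt_set M f X \<subseteq> U"
  proof
    fix x assume x: "x \<in> opt_set M f X"
    have "c k x < q k" if k: "k \<in> {1..m} - active" for k
    proof -
      have "c k x \<le> q k" using opt_set_finite[OF x] k F_finite_iff by auto
      moreover have "c k x \<noteq> q k" using k x ess_inf_ell(1)[of k] by auto
      ultimately show ?thesis by simp
    qed
    then show "x \<in> U" by (simp add: U_def)
  qed
  ultimately obtain \<epsilon> where \<epsilon>: "\<epsilon> > 0" "(\<Union>x\<in>opt_set M f X. ball x \<epsilon>) \<subseteq> U"
    using compact_subset_open_imp_ball_epsilon_subset[OF Xstar_compact] by blast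
  show ?thesis
  proof (rule that[OF \<epsilon>(1)], intro allI impI ballI)
    fix x k assume d: "infdist x (opt_set M f X) < \<epsilon>" and k: "k \<in> {1..m} - active"
    obtain a where "a \<in> opt_set M f X" "infdist x (opt_set M f X) = dist x a"
      using infdist_attains_inf[OF compact_imp_closed[OF Xstar_compact] Xstar_ne] by blast
    then have "x \<in> ball a \<epsilon>" using d by (simp add: dist_commute)
    then have "x \<in> U" using \<epsilon>(2) \<open>a \<in> opt_set M f X\<close> by blast
    then show "c k x < q k" using k by (simp add: U_def)
  qed
qed

text \<open>By \<open>F_finite_iff\<close> the part of the \<epsilon>-sphere in \<open>X\<close>
  where \<open>F\<close> is finite is compact, and \<open>F\<close> is continuous on it, so its
  minimum is attained at a nonoptimal point. The gap is cut into thirds: for the fluctuation at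
  \<open>xb\<close>, the fluctuation at a net point, and the Lipschitz step from the crossing point
  to the net point.\<close>

lemma gap_at_distance:
  assumes "xb \<in> opt_set M f X" "0 < \<epsilon>"
  obtains \<gamma> where "0 < \<gamma>"
    "\<forall>z\<in>X. infdist z (opt_set M f X) = \<epsilon> \<longrightarrow> Fobj M f z < \<infinity> \<longrightarrow> Fr xb + 3 * \<gamma> \<le> Fr z"
proof -
  have S: "compact {x. infdist x (opt_set M f X) \<le> \<epsilon>}"
    by (rule compact_infdist_le[OF Xstar_ne Xstar_compact \<open>0 < \<epsilon>\<close>])
  define K where "K = {x. infdist x (opt_set M f X) \<le> \<epsilon>} \<inter> ({x. infdist x (opt_set M f X) = \<epsilon>} \<inter> X \<inter> (\<Inter>k\<in>{1..m}. {x. c k x \<le> q k}))"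
  have "compact K" unfolding K_def
    by (intro compact_Int_closed[OF S] closed_Int closed_INT closed_Collect_eq closed_Collect_le X_closed ballI
       c_continuous continuous_intros) auto
  have mem: "z \<in> K \<longleftrightarrow> z \<in> X \<and> infdist z (opt_set M f X) = \<epsilon> \<and> Fobj M f z < \<infinity>" for z
    unfolding K_def F_finite_iff by auto
  have cont: "continuous_on K Fr"
    by (rule continuous_on_subset[OF lipschitz_on_continuous_on[OF Fr_lipschitz]]) (auto simp: mem)
  show ?thesis
  proof (cases "K = {}")
    case True
    then show ?thesis using mem by (intro that[of 1]) auto
  next
    case False
    then obtain z0 where z0: "z0 \<in> K" "\<forall>z\<in>K. Fr z0 \<le> Fr z"
      using continuous_attains_inf[OF \<open>compact K\<close> _ cont] by blast
    have "z0 \<notin> opt_set M f X" using z0(1) \<open>0 < \<epsilon>\<close> by (auto simp: mem)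
    then have "Fr xb < Fr z0" using z0(1) by (intro not_optimal_imp_greater assms) (auto simp: mem)
    then show ?thesis using z0(2) by (intro that[of "(Fr z0 - Fr xb) / 3"]) (auto simp: mem field_simps)
  qed
qed

text \<open>
  A far solution would put, on its segment to \<open>xb\<close>, a point \<open>y\<close> at distance exactly \<open>\<epsilon>\<close> from the optimal
  set whose sample average is at most that of \<open>xb\<close>. The point \<open>y\<close> may lie outside the domain of
  \<open>F\<close>, hence the comparison with a nearby net point \<open>z\<close> of that domain.
\<close>
lemma solution_near_opt_set:
  fixes xb :: 'a and \<epsilon> \<gamma> \<eta> \<delta> :: real and Z :: "'a set"
  assumes \<omega>: "\<omega> \<in> space (sample N)" and N: "0 < N"
    and xb: "xb \<in> opt_set M f X" and \<epsilon>: "0 < \<epsilon>"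
    and gap: "\<And>z. z \<in> Z \<Longrightarrow> Fr xb + 3 * \<gamma> \<le> Fr z"
    and \<eta>: "0 < \<eta>" "\<eta> * ((\<integral>\<xi>. \<kappa> \<xi> \<partial>M) + 1) \<le> \<gamma>"
    and net: "\<forall>y\<in>X. infdist y (opt_set M f X) = \<epsilon> \<longrightarrow> (\<forall>k\<in>{1..m}. c k y \<le> q k + \<delta>)
          \<longrightarrow> (\<exists>z\<in>Z. dist y z < \<eta>)"
    and fin: "\<And>i z. i < N \<Longrightarrow> z \<in> insert xb Z \<Longrightarrow> f (\<omega> i) z < \<infinity>"
    and upper: "(\<Sum>i<N. fr (\<omega> i) xb - Fr xb) < real N * \<gamma>"
    and lower: "\<And>z. z \<in> Z \<Longrightarrow> (\<Sum>i<N. Fr z - fr (\<omega> i) z) < real N * \<gamma>"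
    and kap: "(\<Sum>i<N. \<kappa> (\<omega> i)) < real N * ((\<integral>\<xi>. \<kappa> \<xi> \<partial>M) + 1)"
    and quant: "\<And>k. k \<in> {1..m} \<Longrightarrow> \<exists>i<N. ell k (\<omega> i) \<le> q k + \<delta>"
  shows "infdist (xs N \<omega>) (opt_set M f X) < \<epsilon>" "\<And>i. i < N \<Longrightarrow> f (\<omega> i) (xs N \<omega>) < \<infinity>"
proof -
  have \<omega>M: "\<omega> i \<in> space M" if "i < N" for i using \<omega> that by (auto simp: space_PiM)
  have nm: "f (\<omega> i) x \<noteq> - \<infinity>" if "i < N" for i x using f_not_minf[OF \<omega>M[OF that]] .
  define s where "s = xs N \<omega>"
  have s: "s \<in> X" "saa f N \<omega> s \<le> saa f N \<omega> xb"
    using xs_opt[OF \<omega>] xb by (auto simp: s_def opt_set_def)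
  have saab: "saa f N \<omega> xb = ereal ((\<Sum>i<N. fr (\<omega> i) xb) / real N)"
    using nm fin by (intro saa_eq_ereal) auto
  \<comment> \<open>One infinite summand would make the sample average infinite, so the finite value
    at \<open>xb\<close> forces the minimiser to be feasible for every sample point.\<close>
  then have "saa f N \<omega> s < \<infinity>" using s(2) by auto
  then have fs: "f (\<omega> i) s < \<infinity>" if "i < N" for i using saa_finite_imp_finite that by metis
  then show "f (\<omega> i) (xs N \<omega>) < \<infinity>" if "i < N" for i using that by (simp add: s_def)
  have "saa f N \<omega> s = ereal ((\<Sum>i<N. fr (\<omega> i) s) / real N)"
    using nm fs by (intro saa_eq_ereal) auto
  then have opt: "(\<Sum>i<N. fr (\<omega> i) s) \<le> (\<Sum>i<N. fr (\<omega> i) xb)"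
    using s(2) N by (simp add: saab divide_le_cancel)
  show "infdist (xs N \<omega>) (opt_set M f X) < \<epsilon>"
  proof (rule ccontr)
    assume "\<not> ?thesis"
    then have "\<epsilon> \<le> infdist s (opt_set M f X)" by (simp add: s_def)
    then obtain t where t: "0 \<le> t" "t \<le> 1" "infdist ((1 - t) *\<^sub>R xb + t *\<^sub>R s) (opt_set M f X) = \<epsilon>"
      by (rule segment_crosses_infdist_level[OF xb \<epsilon>])
    define y where "y = (1 - t) *\<^sub>R xb + t *\<^sub>R s"
    have yX: "y \<in> X"
      unfolding y_def using X_convex xb s(1) t by (intro convexD) (auto simp: opt_set_def)
    have conv: "f (\<omega> i) y \<le> ereal ((1 - t) * fr (\<omega> i) xb + t * fr (\<omega> i) s)" if i: "i < N" for i
    proof -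
      have "f (\<omega> i) y \<le> ereal (1 - t) * f (\<omega> i) xb + ereal t * f (\<omega> i) s"
        using f_convex[OF \<omega>M[OF i]] t unfolding convex_ext_def y_def by blast
      moreover have "f (\<omega> i) xb = ereal (fr (\<omega> i) xb)"
        using fin[OF i, of xb] nm[OF i, of xb] by (cases "f (\<omega> i) xb") auto
      moreover have "f (\<omega> i) s = ereal (fr (\<omega> i) s)"
        using fs[OF i] nm[OF i, of s] by (cases "f (\<omega> i) s") auto
      ultimately show ?thesis by (metis plus_ereal.simps(1) times_ereal.simps(1))
    qed
    have fy: "f (\<omega> i) y < \<infinity>" if "i < N" for i using conv[OF that] by auto
    have conv': "fr (\<omega> i) y \<le> (1 - t) * fr (\<omega> i) xb + t * fr (\<omega> i) s" if "i < N" for i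
      using conv[OF that] nm[OF that, of y] by (cases "f (\<omega> i) y") auto
    have "(\<Sum>i<N. fr (\<omega> i) y) \<le> (\<Sum>i<N. (1 - t) * fr (\<omega> i) xb + t * fr (\<omega> i) s)"
      by (intro sum_mono conv') auto
    also have "\<dots> = (1 - t) * (\<Sum>i<N. fr (\<omega> i) xb) + t * (\<Sum>i<N. fr (\<omega> i) s)"
      by (simp add: sum.distrib sum_distrib_left)
    also have "\<dots> \<le> (1 - t) * (\<Sum>i<N. fr (\<omega> i) xb) + t * (\<Sum>i<N. fr (\<omega> i) xb)"
      using opt t by (intro add_left_mono mult_left_mono) auto
    finally have sumy: "(\<Sum>i<N. fr (\<omega> i) y) \<le> (\<Sum>i<N. fr (\<omega> i) xb)" by (simp add: algebra_simps)
    \<comment> \<open>Convexity makes \<open>y\<close> feasible for all samples, and some sample has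
      \<open>ell k\<close> within \<delta> of its essential infimum; hence \<open>y\<close> almost
      satisfies the constraints of the domain of \<open>F\<close>.\<close>
    have cy: "c k y \<le> q k + \<delta>" if k: "k \<in> {1..m}" for k
    proof -
      obtain i where i: "i < N" "ell k (\<omega> i) \<le> q k + \<delta>" using quant[OF k] by blast
      have "c k y \<le> ell k (\<omega> i)" using fy[OF i(1)] k by (simp only: dom_iff[OF \<omega>M[OF i(1)]])
      then show ?thesis using i(2) by simp
    qed
    have "infdist y (opt_set M f X) = \<epsilon>" using t(3) by (simp add: y_def)
    then obtain z where z: "z \<in> Z" "dist y z < \<eta>" using net yX cy by blast
    have "fr (\<omega> i) z \<le> fr (\<omega> i) y + \<kappa> (\<omega> i) * \<eta>" if i: "i < N" for i
    proof -
      have "dist (fr (\<omega> i) y) (fr (\<omega> i) z) \<le> \<kappa> (\<omega> i) * dist y z"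
        using lipschitz_onD[OF lip[OF \<omega>M[OF i]], of y z] fy[OF i] fin[OF i, of z] z(1) by simp
      also have "\<dots> \<le> \<kappa> (\<omega> i) * \<eta>"
        using z(2) \<kappa>_nonneg[OF \<omega>M[OF i]] by (intro mult_left_mono) auto
      finally show ?thesis by (simp add: dist_real_def)
    qed
    then have "(\<Sum>i<N. fr (\<omega> i) z) \<le> (\<Sum>i<N. fr (\<omega> i) y + \<kappa> (\<omega> i) * \<eta>)" by (intro sum_mono) auto
    also have "\<dots> = (\<Sum>i<N. fr (\<omega> i) y) + (\<Sum>i<N. \<kappa> (\<omega> i)) * \<eta>"
      by (simp add: sum.distrib sum_distrib_right)
    also have "(\<Sum>i<N. \<kappa> (\<omega> i)) * \<eta> \<le> real N * ((\<integral>\<xi>. \<kappa> \<xi> \<partial>M) + 1) * \<eta>"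
      using kap \<eta>(1) by (intro mult_right_mono) auto
    also have "\<dots> \<le> real N * \<gamma>"
      using mult_left_mono[OF \<eta>(2), of "real N"] by (simp add: mult_ac)
    finally have "(\<Sum>i<N. fr (\<omega> i) z) \<le> (\<Sum>i<N. fr (\<omega> i) xb) + real N * \<gamma>" using sumy by simp
    moreover have "real N * Fr z - (\<Sum>i<N. fr (\<omega> i) z) < real N * \<gamma>"
      using lower[OF z(1)] by (simp add: sum_subtractf)
    moreover have "(\<Sum>i<N. fr (\<omega> i) xb) - real N * Fr xb < real N * \<gamma>"
      using upper by (simp add: sum_subtractf)
    moreover have "real N * (Fr xb + 3 * \<gamma>) \<le> real N * Fr z"
      using gap[OF z(1)] by (intro mult_left_mono) auto
    \<comment> \<open>The chain, per sample: \<open>F\<close> at \<open>z\<close> is less than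
      \<gamma> above the sample average there, which is at most \<gamma> above that at
      \<open>xb\<close>, which is less than \<gamma> above \<open>F\<close> at \<open>xb\<close>.
      This contradicts the gap of three \<gamma>.\<close>
    ultimately show False by (simp add: algebra_simps)
  qed
qed

lemma inactive_constraints_satisfied:
  obtains C \<beta> where "1 \<le> C" "0 < \<beta>"
    "\<forall>N>0. \<exists>B\<in>sets (sample N). measure (sample N) B \<le> C * exp (- real N * \<beta>) \<and>
      (\<forall>\<omega>\<in>space (sample N) - B. (\<forall>k\<in>{1..m} - active. c k (xs N \<omega>) \<le> q k) \<and> (\<forall>i<N. f (\<omega> i) (xs N \<omega>) < \<infinity>))"
proof -
  obtain xb where xb: "xb \<in> opt_set M f X" using Xstar_ne by auto
  obtain \<epsilon> where \<epsilon>: "0 < \<epsilon>" "\<forall>x. infdist x (opt_set M f X) < \<epsilon> \<longrightarrow> (\<forall>k\<in>{1..m} - active. c k x < q k)"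
    by (rule inactive_strict_near_opt_set)
  obtain \<gamma> where \<gamma>: "0 < \<gamma>"
    "\<forall>z\<in>X. infdist z (opt_set M f X) = \<epsilon> \<longrightarrow> Fobj M f z < \<infinity> \<longrightarrow> Fr xb + 3 * \<gamma> \<le> Fr z"
    by (rule gap_at_distance[OF xb \<epsilon>(1)])
  define L where "L = (\<integral>\<xi>. \<kappa> \<xi> \<partial>M)"
  have L: "0 \<le> L" unfolding L_def using \<kappa>_nonneg by (intro Bochner_Integration.integral_nonneg) auto
  \<comment> \<open>With the sampled Lipschitz average below \<open>L + 1\<close>, moving by less
    than \<eta> changes the sample average by at most \<gamma>.\<close>
  define \<eta> where "\<eta> = \<gamma> / (L + 1)"
  have \<eta>: "0 < \<eta>" "\<eta> * (L + 1) \<le> \<gamma>" using L \<gamma>(1) by (auto simp: \<eta>_def)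
  \<comment> \<open>Intersecting with the compact neighbourhood makes the closed \<epsilon>-sphere
    compact.\<close>
  define S where "S = {x. infdist x (opt_set M f X) \<le> \<epsilon>} \<inter> ({x. infdist x (opt_set M f X) = \<epsilon>} \<inter> X)"
  have S: "compact S" unfolding S_def
    by (intro compact_Int_closed[OF compact_infdist_le[OF Xstar_ne Xstar_compact \<epsilon>(1)]] closed_Int X_closed
        closed_Collect_eq continuous_intros)
  obtain Z \<delta> where Z: "finite Z" "Z \<subseteq> S" "\<forall>z\<in>Z. \<forall>k\<in>{1..m}. c k z \<le> q k" "0 < \<delta>"
    "\<forall>y\<in>S. (\<forall>k\<in>{1..m}. c k y \<le> q k + \<delta>) \<longrightarrow> (\<exists>z\<in>Z. dist y z < \<eta>)"
    by (rule finite_net_of_relaxation[OF S finite_atLeastAtMost c_continuous \<eta>(1), where q=q])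
  have ZF: "Fobj M f z < \<infinity>" if "z \<in> insert xb Z" for z
    using that Z(3) opt_set_finite[OF xb] F_finite_iff by auto
  \<comment> \<open>If every sample point lay in \<open>A k\<close>, the sample would not reveal
    constraint \<open>k\<close> to within \<delta>.\<close>
  define A where "A k = {\<xi> \<in> space M. \<not> ell k \<xi> \<le> q k + \<delta>}" for k
  \<comment> \<open>Each pair holds a function and the threshold its sample average must stay below,
    so one union bound treats all exceptional events.\<close>
  define T :: "(('b \<Rightarrow> real) \<times> real) set" where
    "T = insert (\<kappa>, L + 1) (insert (\<lambda>\<xi>. fr \<xi> xb - Fr xb, \<gamma>)
       ((\<lambda>z. (\<lambda>\<xi>. Fr z - fr \<xi> z, \<gamma>)) ` Z \<union> (\<lambda>k. (indicator (A k), 1)) ` {1..m}))"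
  define E where "E N \<tau> = {\<omega> \<in> space (sample N). real N * snd \<tau> \<le> (\<Sum>i<N. fst \<tau> (\<omega> i))}" for N :: nat and \<tau> :: "('b \<Rightarrow> real) \<times> real"
  have A: "A k \<in> sets M" "measure M (A k) < 1" if k: "k \<in> {1..m}" for k
  proof -
    note [measurable] = ell_meas[OF k]
    show "A k \<in> sets M" unfolding A_def by measurable
    have "measure M (A k) = 1 - measure M {\<xi> \<in> space M. ell k \<xi> \<le> q k + \<delta>}"
      unfolding A_def by (rule prob_neg) measurable
    then show "measure M (A k) < 1" using ess_inf_ell(3)[OF k Z(4)] by simp
  qed
  have finT: "finite T" using Z(1) by (simp add: T_def)
  have T_meas: "fst \<tau> \<in> borel_measurable M" if "\<tau> \<in> T" for \<tau>
  proof -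
    have [measurable]: "\<kappa> \<in> borel_measurable M" "\<And>x. (\<lambda>\<xi>. f \<xi> x) \<in> borel_measurable M"
      using \<kappa>_int f_meas by auto
    have "(\<lambda>\<xi>. fr \<xi> x - Fr x) \<in> borel_measurable M" "(\<lambda>\<xi>. Fr x - fr \<xi> x) \<in> borel_measurable M" for x
      by measurable
    moreover have "(indicator (A k) :: 'b \<Rightarrow> real) \<in> borel_measurable M" if "k \<in> {1..m}" for k
      using A(1)[OF that] by simp
    ultimately show ?thesis using that by (auto simp: T_def)
  qed
  have E_sets: "E N \<tau> \<in> sets (sample N)" if "\<tau> \<in> T" for N \<tau>
  proof -
    have [measurable]: "(\<lambda>\<omega>. fst \<tau> (\<omega> i)) \<in> borel_measurable (sample N)" if "i \<in> {..<N}" for i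
      by (rule measurable_compose[OF measurable_component_singleton[OF that] T_meas[OF \<open>\<tau> \<in> T\<close>]])
    show ?thesis unfolding E_def by measurable
  qed
  have E_tail: "\<exists>\<theta>>0. \<forall>N. measure (sample N) (E N \<tau>) \<le> exp (- real N * \<theta>)" if \<tau>: "\<tau> \<in> T" for \<tau>
  proof -
    consider "\<tau> = (\<kappa>, L + 1)" | "\<tau> = (\<lambda>\<xi>. fr \<xi> xb - Fr xb, \<gamma>)"
      | z where "z \<in> Z" "\<tau> = (\<lambda>\<xi>. Fr z - fr \<xi> z, \<gamma>)" | k where "k \<in> {1..m}" "\<tau> = (indicator (A k), 1)"
      using \<tau> unfolding T_def by blast
    then show ?thesis
    proof cases
      case 1
      then show ?thesis using chernoff_kappa by (simp add: E_def L_def)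
    next
      case 2
      then show ?thesis using chernoff_f(1)[OF ZF \<gamma>(1), of xb] by (simp add: E_def)
    next
      case 3
      then show ?thesis using chernoff_f(2)[OF ZF \<gamma>(1), of z] by (simp add: E_def)
    next
      case 4
      then show ?thesis using chernoff_indicator[OF A] by (simp add: E_def)
    qed
  qed
  have "\<exists>\<theta>>0. \<forall>N. measure (sample N) (\<Union>\<tau>\<in>T. E N \<tau>) \<le> real (card T) * exp (- real N * \<theta>)"
    by (rule exponential_union_bound[OF _ finT E_sets E_tail]) (intro prob_space_PiM prob_space_axioms)
  then obtain \<theta> where \<theta>: "\<theta> > 0" "\<And>N. measure (sample N) (\<Union>\<tau>\<in>T. E N \<tau>) \<le> real (card T) * exp (- real N * \<theta>)"
    by auto
  have good: "\<forall>N>0. \<exists>B\<in>sets (sample N). measure (sample N) B \<le> real (card T) * exp (- real N * \<theta>) \<and>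
      (\<forall>\<omega>\<in>space (sample N) - B. (\<forall>k\<in>{1..m} - active. c k (xs N \<omega>) \<le> q k) \<and> (\<forall>i<N. f (\<omega> i) (xs N \<omega>) < \<infinity>))"
  proof (intro allI impI)
    fix N :: nat assume N: "0 < N"
    interpret P: prob_space "sample N" by (intro prob_space_PiM prob_space_axioms)
    \<comment> \<open>Finiteness at \<open>xb\<close> and at the net points can fail only on a null
      set, which joins the exceptional event at no cost.\<close>
    have "AE \<omega> in sample N. f (\<omega> i) z < \<infinity>" if "i \<in> {..<N}" "z \<in> insert xb Z" for i z
      using AE_PiM_component[OF _ that(1), of "\<lambda>_. M"] F_finite(1)[OF ZF[OF that(2)]] prob_space_axioms by blast
    then have "AE \<omega> in sample N. \<forall>i\<in>{..<N}. \<forall>z\<in>insert xb Z. f (\<omega> i) z < \<infinity>"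
      using Z(1) by (intro AE_ball_countable') (auto intro: countable_finite)
    then obtain B0 where B0: "{\<omega> \<in> space (sample N). \<not> (\<forall>i\<in>{..<N}. \<forall>z\<in>insert xb Z. f (\<omega> i) z < \<infinity>)} \<subseteq> B0"
        "emeasure (sample N) B0 = 0" "B0 \<in> sets (sample N)"
      by (rule AE_E)
    define B1 where "B1 = (\<Union>\<tau>\<in>T. E N \<tau>)"
    have B1: "B1 \<in> sets (sample N)" unfolding B1_def using finT E_sets by auto
    have "measure (sample N) (B0 \<union> B1) \<le> measure (sample N) B0 + measure (sample N) B1"
      using B0(3) B1 by (rule measure_Un_le)
    also have "\<dots> \<le> real (card T) * exp (- real N * \<theta>)"
      using \<theta>(2)[of N] B0(2) by (simp add: B1_def measure_def)
    finally have meas: "measure (sample N) (B0 \<union> B1) \<le> real (card T) * exp (- real N * \<theta>)" .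
    have "(\<forall>k\<in>{1..m} - active. c k (xs N \<omega>) \<le> q k) \<and> (\<forall>i<N. f (\<omega> i) (xs N \<omega>) < \<infinity>)"
      if \<omega>: "\<omega> \<in> space (sample N) - (B0 \<union> B1)" for \<omega>
    proof -
      have \<omega>M: "\<omega> i \<in> space M" if "i < N" for i using \<omega> that by (auto simp: space_PiM)
      have notE: "(\<Sum>i<N. fst \<tau> (\<omega> i)) < real N * snd \<tau>" if "\<tau> \<in> T" for \<tau>
        using \<omega> that by (auto simp: B1_def E_def not_le)
      have quant: "\<exists>i<N. ell k (\<omega> i) \<le> q k + \<delta>" if k: "k \<in> {1..m}" for k
      proof (rule ccontr)
        assume "\<not> ?thesis"
        then have "(\<Sum>i<N. indicator (A k) (\<omega> i) :: real) = (\<Sum>i<N. 1)"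
          using \<omega>M by (intro sum.cong) (auto simp: A_def)
        moreover have "(\<Sum>i<N. indicator (A k) (\<omega> i) :: real) < real N * 1"
          using notE[of "(indicator (A k), 1)"] k by (auto simp: T_def)
        ultimately show False by simp
      qed
      have 0: "\<omega> \<in> space (sample N)" using \<omega> by simp
      have 1: "Fr xb + 3 * \<gamma> \<le> Fr z" if "z \<in> Z" for z
        using that Z(2) ZF[of z] \<gamma>(2) by (auto simp: S_def)
      have 2: "\<forall>y\<in>X. infdist y (opt_set M f X) = \<epsilon> \<longrightarrow> (\<forall>k\<in>{1..m}. c k y \<le> q k + \<delta>)
          \<longrightarrow> (\<exists>z\<in>Z. dist y z < \<eta>)"
        using Z(5) by (simp add: S_def)
      have 3: "f (\<omega> i) z < \<infinity>" if "i < N" "z \<in> insert xb Z" for i z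
        using B0(1) \<omega> that by blast
      have 4: "(\<Sum>i<N. fr (\<omega> i) xb - Fr xb) < real N * \<gamma>"
        using notE[of "(\<lambda>\<xi>. fr \<xi> xb - Fr xb, \<gamma>)"] by (simp add: T_def)
      have 5: "(\<Sum>i<N. Fr z - fr (\<omega> i) z) < real N * \<gamma>" if "z \<in> Z" for z
        using notE[of "(\<lambda>\<xi>. Fr z - fr \<xi> z, \<gamma>)"] that by (simp add: T_def)
      have 6: "(\<Sum>i<N. \<kappa> (\<omega> i)) < real N * ((\<integral>\<xi>. \<kappa> \<xi> \<partial>M) + 1)"
        using notE[of "(\<kappa>, L + 1)"] by (simp add: T_def L_def)
      note near = solution_near_opt_set[OF 0 N xb \<epsilon>(1) 1 \<eta>[unfolded L_def] 2 3 4 5 6 quant]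
      show ?thesis using near(2) \<epsilon>(2)[rule_format, OF near(1)] by (intro conjI ballI allI impI less_imp_le)
    qed
    then show "\<exists>B\<in>sets (sample N). measure (sample N) B \<le> real (card T) * exp (- real N * \<theta>) \<and>
      (\<forall>\<omega>\<in>space (sample N) - B. (\<forall>k\<in>{1..m} - active. c k (xs N \<omega>) \<le> q k) \<and> (\<forall>i<N. f (\<omega> i) (xs N \<omega>) < \<infinity>))"
      using meas B0(3) B1 by (intro bexI[of _ "B0 \<union> B1"] conjI ballI) (auto intro: sets.Un)
  qed
  \<comment> \<open>A constant of at least 1 is what later makes the bound trivial for the empty
    sample.\<close>
  have "1 \<le> real (card T)"
  proof -
    have "T \<noteq> {}" by (simp add: T_def)
    then show ?thesis using finT by (simp add: Suc_le_eq card_gt_0_iff)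
  qed
  then show ?thesis using \<theta>(1) good by (rule that)
qed

section \<open>From undercutting to the degree of feasibility\<close>

text \<open>The number \<open>c k x\<close> separates the two sides: a fresh violation puts
  \<open>ell k\<close> below it, while feasibility puts every sampled value at or above it. Outside
  \<open>K\<close> a violation would require \<open>ell k\<close> below its essential infimum. The
  bound no longer contains \<open>x\<close>, so \<open>x\<close> may depend on the sample in any
  way.\<close>

lemma infeasibility_le_undercut:
  assumes \<omega>: "\<omega> \<in> space (sample N)" and "K \<subseteq> {1..m}"
    and inactive: "\<And>k. k \<in> {1..m} - K \<Longrightarrow> c k x \<le> q k"
    and feas: "\<And>i. i < N \<Longrightarrow> f (\<omega> i) x < \<infinity>"
  shows "1 - feas_degree M f x \<le> measure M (undercut ell K {..<N} (space M) \<omega>)"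
proof -
  have finK: "finite K" using \<open>K \<subseteq> {1..m}\<close> by (rule finite_subset) simp
  have ellK: "ell k \<in> borel_measurable M" if "k \<in> K" for k using \<open>K \<subseteq> {1..m}\<close> that ell_meas by auto
  note [measurable] = f_meas
  have "1 - feas_degree M f x = measure M {\<xi> \<in> space M. \<not> f \<xi> x < \<infinity>}"
    unfolding feas_degree_def by (rule prob_neg[symmetric]) measurable
  also have "\<dots> \<le> measure M (undercut ell K {..<N} (space M) \<omega>)"
  proof (rule finite_measure_mono_AE)
    have "AE \<xi> in M. \<forall>k\<in>{1..m}. q k \<le> ell k \<xi>" by (intro AE_ball_countable' ess_inf_ell(2)) auto
    then show "AE \<xi> in M. \<xi> \<in> {\<xi> \<in> space M. \<not> f \<xi> x < \<infinity>} \<longrightarrow> \<xi> \<in> undercut ell K {..<N} (space M) \<omega>"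
    proof (rule eventually_mono, intro impI)
      fix \<xi> assume ge: "\<forall>k\<in>{1..m}. q k \<le> ell k \<xi>" and "\<xi> \<in> {\<xi> \<in> space M. \<not> f \<xi> x < \<infinity>}"
      then have \<xi>: "\<xi> \<in> space M" "\<not> f \<xi> x < \<infinity>" by auto
      then obtain k where k: "k \<in> {1..m}" "ell k \<xi> < c k x" using dom_iff[OF \<xi>(1), of x] by (meson not_le)
      have "k \<in> K"
      proof (rule ccontr)
        assume "k \<notin> K"
        then have "c k x \<le> q k" using k(1) inactive by auto
        moreover have "q k \<le> ell k \<xi>" using ge k(1) by blast
        ultimately show False using k(2) by simp
      qed
      moreover have "ell k \<xi> < ell k (\<omega> i)" if i: "i < N" for i
      proof -
        have "\<omega> i \<in> space M" using \<omega> i by (auto simp: space_PiM)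
        then have "c k x \<le> ell k (\<omega> i)" using feas[OF i] k(1) dom_iff by blast
        then show ?thesis using k(2) by simp
      qed
      ultimately show "\<xi> \<in> undercut ell K {..<N} (space M) \<omega>" using \<xi>(1) by (auto simp: undercut_def)
    qed
    show "undercut ell K {..<N} (space M) \<omega> \<in> events"
      by (intro undercut_sets finK ellK) auto
  qed
  finally show ?thesis .
qed

lemma feasibility_tail:
  "\<exists>\<alpha>bar>0. \<exists>C>0. \<exists>\<beta>>0. \<forall>N \<ge> card active. \<forall>\<alpha>. 0 \<le> \<alpha> \<and> \<alpha> < \<alpha>bar \<longrightarrow>
     outer_prob (sample N) {\<omega> \<in> space (sample N). feas_degree M f (xs N \<omega>) < 1 - \<alpha>}
     \<le> C * exp (- real N * \<beta>) + (\<Sum>k<card active. real (N choose k) * \<alpha> ^ k * (1 - \<alpha>) ^ (N - k))"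
proof -
  obtain C \<beta> where C: "1 \<le> C" "0 < \<beta>" and
    good: "\<forall>N>0. \<exists>B\<in>sets (sample N). measure (sample N) B \<le> C * exp (- real N * \<beta>) \<and>
      (\<forall>\<omega>\<in>space (sample N) - B. (\<forall>k\<in>{1..m} - active. c k (xs N \<omega>) \<le> q k) \<and> (\<forall>i<N. f (\<omega> i) (xs N \<omega>) < \<infinity>))"
    by (rule inactive_constraints_satisfied)
  have "outer_prob (sample N) {\<omega> \<in> space (sample N). feas_degree M f (xs N \<omega>) < 1 - \<alpha>}
     \<le> C * exp (- real N * \<beta>) + (\<Sum>k<card active. real (N choose k) * \<alpha> ^ k * (1 - \<alpha>) ^ (N - k))"
    (is "outer_prob _ ?bad \<le> _ + ?binom")
    if \<alpha>: "0 \<le> \<alpha>" "\<alpha> < 1" for N \<alpha>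
  proof -
    interpret P: prob_space "sample N" by (intro prob_space_PiM prob_space_axioms)
    have binom: "0 \<le> ?binom" using \<alpha> by (intro sum_nonneg) auto
    show ?thesis
    \<comment> \<open>The empty sample says nothing about \<open>xs\<close>, so here the bound rests
      on \<open>C\<close> being at least 1.\<close>
    proof (cases "N = 0")
      case True
      have "outer_prob (sample N) ?bad \<le> measure (sample N) (space (sample N))"
        by (intro outer_prob_le) auto
      also have "\<dots> = 1" by (rule P.prob_space)
      also have "1 \<le> C * exp (- real N * \<beta>)" using True C by simp
      finally show ?thesis using binom by linarith
    next
      case False
      then have "0 < N" by simp
      from good[rule_format, OF this] obtain B where B: "B \<in> sets (sample N)" "measure (sample N) B \<le> C * exp (- real N * \<beta>)"
        and inact: "\<forall>\<omega>\<in>space (sample N) - B.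
         (\<forall>k\<in>{1..m} - active. c k (xs N \<omega>) \<le> q k) \<and> (\<forall>i<N. f (\<omega> i) (xs N \<omega>) < \<infinity>)"
        by (elim bexE conjE)
      have ell': "ell k \<in> borel_measurable M" if "k \<in> active" for k using that ell_meas by auto
      define V where "V = {\<omega> \<in> space (sample N). \<alpha> < measure M (undercut ell active {..<N} (space M) \<omega>)}"
      have [measurable]: "(\<lambda>\<omega>. measure M (undercut ell active {..<N} (space M) \<omega>)) \<in> borel_measurable (sample N)"
        by (intro measurable_undercut prob_space_axioms ell') auto
      have V: "V \<in> sets (sample N)" unfolding V_def by measurable
      have "emeasure (sample N) V \<le> ennreal (\<Sum>j<card active. real (card {..<N} choose j) * \<alpha> ^ j * (1 - \<alpha>) ^ (card {..<N} - j))"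
        unfolding V_def using \<alpha> by (intro emeasure_undercut_le prob_space_axioms ell') auto
      then have mV: "measure (sample N) V \<le> ?binom"
        using binom by (simp add: P.emeasure_eq_measure)
      \<comment> \<open>The bad set may be nonmeasurable; this measurable cover bounds its outer
        probability.\<close>
      have "?bad \<subseteq> B \<union> V"
      proof
        fix \<omega> assume "\<omega> \<in> ?bad"
        then have \<omega>: "\<omega> \<in> space (sample N)" "\<alpha> < 1 - feas_degree M f (xs N \<omega>)" by auto
        show "\<omega> \<in> B \<union> V"
        proof (cases "\<omega> \<in> B")
          case False
          then have \<omega>B: "\<omega> \<in> space (sample N) - B" using \<omega>(1) by simp
          have "1 - feas_degree M f (xs N \<omega>) \<le> measure M (undercut ell active {..<N} (space M) \<omega>)"
          proof (rule infeasibility_le_undercut[OF \<omega>(1)])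
            show "active \<subseteq> {1..m}" by (rule Collect_restrict)
          qed (rule inact[rule_format, OF \<omega>B, THEN conjunct1, rule_format] inact[rule_format, OF \<omega>B, THEN conjunct2, rule_format], assumption)+
          then show ?thesis using \<omega> by (simp add: V_def)
        qed simp
      qed
      then have "outer_prob (sample N) ?bad \<le> measure (sample N) (B \<union> V)"
        using B(1) V by (intro outer_prob_le) auto
      also have "\<dots> \<le> measure (sample N) B + measure (sample N) V"
        using B(1) V by (rule measure_Un_le)
      finally show ?thesis using B(2) mV by linarith
    qed
  qed
  \<comment> \<open>The estimate holds for every \<alpha> in \<open>[0, 1)\<close>, so 1 is the
    witness for \<open>\<alpha>bar\<close>.\<close>
  then show ?thesis using C by (intro exI[of _ 1] exI[of _ C] exI[of _ \<beta>] conjI) auto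
qed

end

theorem theorem3p5:
  fixes M :: "'b measure"
    and f :: "'b \<Rightarrow> 'a::euclidean_space \<Rightarrow> ereal"
    and X :: "'a set"
    and m :: nat
    and c :: "nat \<Rightarrow> 'a \<Rightarrow> real"
    and ell :: "nat \<Rightarrow> 'b \<Rightarrow> real"
    and \<kappa> :: "'b \<Rightarrow> real"
    and L :: real
    and xs :: "nat \<Rightarrow> (nat \<Rightarrow> 'b) \<Rightarrow> 'a"
  defines "J \<equiv> {k \<in> {1..m}. \<exists>x\<in>opt_set M f X. ereal (c k x) = quantile_lvl M (ell k) 0}"
  assumes P: "prob_space M"
    and X_closed: "closed X" and X_convex: "convex X" and X_ne: "X \<noteq> {}"
    and f_meas: "\<And>x. (\<lambda>\<xi>. f \<xi> x) \<in> borel_measurable M"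
    and f_not_minf: "\<And>\<xi> x. \<xi> \<in> space M \<Longrightarrow> f \<xi> x \<noteq> -\<infinity>"
    and f_convex: "\<And>\<xi>. \<xi> \<in> space M \<Longrightarrow> convex_ext (f \<xi>)"
    and F_gt: "\<And>x. Fobj M f x > -\<infinity>"
    and F_fin: "\<exists>x\<in>X. Fobj M f x < \<infinity>"
    and Xstar_ne: "opt_set M f X \<noteq> {}" and Xstar_compact: "compact (opt_set M f X)"
    and dom_f: "\<And>\<xi>. \<xi> \<in> space M \<Longrightarrow>
        {x. f \<xi> x < \<infinity>} = {x. \<forall>k\<in>{1..m}. c k x \<le> ell k \<xi>}"
    and c_convex: "\<And>k. k \<in> {1..m} \<Longrightarrow> convex_on UNIV (c k)"
    and ell_meas: "\<And>k. k \<in> {1..m} \<Longrightarrow> ell k \<in> borel_measurable M"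
    and \<kappa>_nonneg: "\<And>\<xi>. \<xi> \<in> space M \<Longrightarrow> \<kappa> \<xi> \<ge> 0"
    and \<kappa>_int: "integrable M \<kappa>" and \<kappa>_L: "(\<integral>\<xi>. \<kappa> \<xi> \<partial>M) = L"
    and lip: "\<And>\<xi>. \<xi> \<in> space M \<Longrightarrow>
        lipschitz_on (\<kappa> \<xi>) {x. f \<xi> x < \<infinity>} (\<lambda>x. real_of_ereal (f \<xi> x))"
    and C1C3: "\<And>K. compact K \<Longrightarrow> K \<subseteq> {x. Fobj M f x < \<infinity>} \<Longrightarrow>
        (\<forall>x\<in>K. \<exists>\<delta>>0. \<forall>t. \<bar>t\<bar> < \<delta> \<longrightarrow>
            integrable M (\<lambda>\<xi>. exp (t * (real_of_ereal (f \<xi> x) - real_of_ereal (Fobj M f x)))))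
        \<and> (\<exists>\<delta>>0. \<forall>t. \<bar>t\<bar> < \<delta> \<longrightarrow> integrable M (\<lambda>\<xi>. exp (t * \<kappa> \<xi>)))"
    and xs_opt: "\<And>N \<omega>. \<omega> \<in> space (PiM {..<N} (\<lambda>_. M)) \<Longrightarrow>
        xs N \<omega> \<in> X \<and> (\<forall>y\<in>X. saa f N \<omega> (xs N \<omega>) \<le> saa f N \<omega> y)"
  shows "\<exists>\<alpha>bar>0. \<exists>C>0. \<exists>\<beta>>0. \<forall>N \<ge> card J. \<forall>\<alpha>. 0 \<le> \<alpha> \<and> \<alpha> < \<alpha>bar \<longrightarrow>
     outer_prob (PiM {..<N} (\<lambda>_. M))
        {\<omega> \<in> space (PiM {..<N} (\<lambda>_. M)). feas_degree M f (xs N \<omega>) < 1 - \<alpha>}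
     \<le> C * exp (- real N * \<beta>)
        + (\<Sum>k<card J. real (N choose k) * \<alpha> ^ k * (1 - \<alpha>) ^ (N - k))"
proof -
  interpret saa_problem M f X m c ell \<kappa> xs
    by (intro saa_problem.intro saa_problem_axioms.intro) fact+
  show ?thesis unfolding J_def by (rule feasibility_tail)
qed

end
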